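(* In the Gaussian white noise model with the Poisson–Gaussian sieve prior $\Pi$ described in the context, the global $l^2$ rate of posterior contraction is optimal adaptive (up to a logarithmic term): for every $L_0>0$ and $\beta_2\ge\beta_1>1/2$ there is a constant $\epsilon_0>0$ (not depending on $\beta$) such that, for $M$ large enough, $$\sup_{\beta_1\le\beta\le\beta_2}\ \sup_{\boldsymbol\theta_0\in\Theta_\beta(L_0)}\mathbb{E}_0^{(n)}\,\Pi\Big(\boldsymbol\theta:\ \|\boldsymbol\theta-\boldsymbol\theta_0\|_2^2\ge M\frac{\log n}{L(n)}\epsilon_n^2(\beta)\ \Big|\ X^n\Big)\underset{n\to\infty}{\longrightarrow}0,$$ with $\epsilon_n(\beta)=\epsilon_0\left(\frac{\log n}{n}\right)^{\frac{\beta}{2\beta+1}}$ and $L(n)=\log n$.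
   Context: White noise model (sequence form). One observes $X^n=(X_j^n)_{j\ge1}$ with $X_j^n=\theta_{0j}+\frac{1}{\sqrt n}\xi_j$, $j=1,2,\ldots$, where the $\xi_j$ are independent standard Gaussian variables and $\boldsymbol\theta_0=(\theta_{0j})_{j\ge1}\in l^2$ is unknown. (Equivalently $dX^n(t)=\boldsymbol f_0(t)dt+n^{-1/2}dW(t)$ on $[0,1]$, $W$ a standard Brownian motion, with $\theta_{0j}$ the Fourier coefficients of $\boldsymbol f_0\in L^2(0,1)$ in a Fourier orthonormal basis.) $\mathbb{E}_0^{(n)}$ is the expectation under $\boldsymbol\theta_0$; $\|\cdot\|_2$ is the $l^2$ norm. Sobolev classes. $\Theta_\beta(L_0)=\{\boldsymbol\theta:\sum_{j\ge1}\theta_j^2j^{2\beta}<L_0\}$, $\beta>1/2$, $L_0>0$. Prior $\Pi$. $k\sim\mathrm{Poisson}(\lambda)$ with fixed $\lambda>0$; given $k$, the variables $\theta_j/\tau_j$, $j=1,\ldots,k$, are independent $\mathcal{N}(0,1)$ and $\theta_j=0$ for $j>k$; the scales are $\tau_j^2=\tau_0j^{-2q}$ with $\tau_0>0$ and $1/2<q\le1$. $\Pi(\cdot|X^n)$ is the corresponding posterior distribution. The slowly varying function attached to the Poisson prior is $L=\log$. *)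

theory Defs
  imports "HOL-Probability.Probability"
begin

text \<open>
  Real sequences \<open>(\<theta>\<^sub>j)\<close> with \<open>j \<ge> 1\<close> are the elements of \<open>space seq_borel\<close>, i.e. functions on
  \<open>nat\<close> that are \<open>undefined\<close> at the unused index \<open>0\<close>. Series run over \<open>j = Suc i\<close>.
\<close>

abbreviation seq_borel :: "(nat \<Rightarrow> real) measure" where
  "seq_borel \<equiv> Pi\<^sub>M {1..} (\<lambda>_. borel)"

text \<open>Series of nonnegative terms are taken in \<open>ennreal\<close>, so that divergence means \<open>\<infinity>\<close>.\<close>

definition l2_norm_sq :: "(nat \<Rightarrow> real) \<Rightarrow> ennreal" where
  "l2_norm_sq \<theta> = (\<Sum>i. ennreal ((\<theta> (Suc i))\<^sup>2))"

definition sobolev_class :: "real \<Rightarrow> real \<Rightarrow> (nat \<Rightarrow> real) set" where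
  "sobolev_class \<beta> L0 =
     {\<theta> \<in> space seq_borel.
        (\<Sum>i. ennreal ((\<theta> (Suc i))\<^sup>2 * real (Suc i) powr (2 * \<beta>))) < ennreal L0}"

definition std_gaussian_noise :: "(nat \<Rightarrow> real) measure" where
  "std_gaussian_noise = Pi\<^sub>M {1..} (\<lambda>_. density lborel std_normal_density)"

definition white_noise :: "nat \<Rightarrow> (nat \<Rightarrow> real) \<Rightarrow> (nat \<Rightarrow> real) measure" where
  "white_noise n \<theta> =
     distr std_gaussian_noise seq_borel (\<lambda>\<xi>. \<lambda>j\<in>{1..}. \<theta> j + 1 / sqrt (real n) * \<xi> j)"

definition prior_scale :: "real \<Rightarrow> real \<Rightarrow> nat \<Rightarrow> real" where
  "prior_scale \<tau>0 q j = sqrt (\<tau>0 * real j powr (- 2 * q))"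

definition sieve_prior_given :: "real \<Rightarrow> real \<Rightarrow> nat \<Rightarrow> (nat \<Rightarrow> real) measure" where
  "sieve_prior_given \<tau>0 q k =
     Pi\<^sub>M {1..} (\<lambda>j. if j \<le> k then density lborel (normal_density 0 (prior_scale \<tau>0 q j))
                     else return borel 0)"

definition sieve_prior :: "real \<Rightarrow> real \<Rightarrow> real \<Rightarrow> (nat \<Rightarrow> real) measure" where
  "sieve_prior rate \<tau>0 q = measure_pmf (poisson_pmf rate) \<bind> sieve_prior_given \<tau>0 q"

text \<open>
  A posterior is a regular conditional distribution of \<open>\<theta>\<close> given the observation under the joint
  law \<open>\<theta> \<sim> prior\<close>, \<open>X | \<theta> \<sim> P \<theta>\<close>. The marginal law of \<open>X\<close> is \<open>prior \<bind> P\<close>, and the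
  equation says that both sides are the probability of \<open>\<theta> \<in> B\<close> and \<open>X \<in> A\<close>.
\<close>

definition is_posterior ::
  "'t measure \<Rightarrow> 'x measure \<Rightarrow> 't measure \<Rightarrow> ('t \<Rightarrow> 'x measure) \<Rightarrow> ('x \<Rightarrow> 't measure) \<Rightarrow> bool" where
  "is_posterior T X prior P \<kappa> \<longleftrightarrow>
     \<kappa> \<in> X \<rightarrow>\<^sub>M prob_algebra T \<and>
     (\<forall>A\<in>sets X. \<forall>B\<in>sets T.
        (\<integral>\<^sup>+ x\<in>A. emeasure (\<kappa> x) B \<partial>(prior \<bind> P)) = (\<integral>\<^sup>+ \<theta>\<in>B. emeasure (P \<theta>) A \<partial>prior))"

definition slowly_varying :: "nat \<Rightarrow> real" where
  "slowly_varying n = ln (real n)"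

definition rate_eps :: "real \<Rightarrow> real \<Rightarrow> nat \<Rightarrow> real" where
  "rate_eps \<epsilon>0 \<beta> n = \<epsilon>0 * (ln (real n) / real n) powr (\<beta> / (2 * \<beta> + 1))"

text \<open>The prior is a probability measure on sequence space and the model is a Markov kernel.\<close>

lemma prob_space_std_gaussian_noise: "prob_space std_gaussian_noise"
  unfolding std_gaussian_noise_def
  by (intro prob_space_PiM prob_space_normal_density) simp

lemma sets_std_gaussian_noise [measurable_cong]: "sets std_gaussian_noise = sets seq_borel"
  unfolding std_gaussian_noise_def by (intro sets_PiM_cong) auto

lemma white_noise_kernel: "white_noise n \<in> seq_borel \<rightarrow>\<^sub>M prob_algebra seq_borel"
proof -
  have f: "(\<lambda>(\<theta>, \<xi>). \<lambda>j\<in>{1..}. \<theta> j + 1 / sqrt (real n) * \<xi> j)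
             \<in> seq_borel \<Otimes>\<^sub>M std_gaussian_noise \<rightarrow>\<^sub>M seq_borel"
    unfolding split_beta'
    by (intro measurable_restrict borel_measurable_add borel_measurable_times
          borel_measurable_const
          measurable_compose[OF measurable_fst measurable_component_singleton]
          measurable_compose[OF measurable_snd])
       (auto simp: measurable_cong_sets[OF sets_std_gaussian_noise refl])
  have g: "(\<lambda>_. std_gaussian_noise) \<in> seq_borel \<rightarrow>\<^sub>M prob_algebra std_gaussian_noise"
    by (simp add: space_prob_algebra prob_space_std_gaussian_noise)
  show ?thesis
    unfolding white_noise_def by (rule measurable_distr_prob_space2[OF g f])
qed

lemma sieve_prior_given_prob:
  assumes "\<tau>0 > 0"
  shows "sieve_prior_given \<tau>0 q k \<in> space (prob_algebra seq_borel)"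
proof -
  have "prob_space (sieve_prior_given \<tau>0 q k)"
    unfolding sieve_prior_given_def
    by (intro prob_space_PiM)
       (use assms in \<open>auto simp: prior_scale_def intro!: prob_space_normal_density prob_space_return\<close>)
  moreover have "sets (sieve_prior_given \<tau>0 q k) = sets seq_borel"
    unfolding sieve_prior_given_def by (intro sets_PiM_cong) auto
  ultimately show ?thesis by (simp add: space_prob_algebra)
qed

lemma sieve_prior_prob:
  assumes "\<tau>0 > 0"
  shows "sieve_prior rate \<tau>0 q \<in> space (prob_algebra seq_borel)"
proof -
  have A: "measure_pmf (poisson_pmf rate) \<in> space (prob_algebra (count_space UNIV))"
    by (simp add: space_prob_algebra measure_pmf.prob_space_axioms)
  have B: "sieve_prior_given \<tau>0 q \<in> count_space UNIV \<rightarrow>\<^sub>M prob_algebra seq_borel"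
    using sieve_prior_given_prob[OF assms] by simp
  show ?thesis
    unfolding sieve_prior_def
    using prob_space_bind'[OF A B] sets_bind'[OF A B] by (simp add: space_prob_algebra)
qed

end

theory Submission
  imports Defs
begin

text \<open>
  The posterior is only determined up to null sets of the marginal law \<open>m\<close> of the data, and every
  exact identity about it is an identity under \<open>m\<close>, whereas the claim is about the law \<open>P\<^sub>0\<close> of the
  data at the true sequence \<open>\<theta>\<^sub>0\<close>. The proof transports bounds from \<open>m\<close> to \<open>P\<^sub>0\<close> by an inequality
  \<open>P\<^sub>0(S)\<^sup>2 \<le> exp (C R) m(S)\<close> for every event \<open>S\<close>, where \<open>R = k ln n\<close> and
  \<open>k = \<lceil>(n / ln n)\<^bsup>1/(2\<beta>+1)\<^esup>\<rceil>\<close>, so that \<open>R / n\<close> is of the order of the squared rate.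

  The inequality comes from Cauchy-Schwarz: the likelihood ratio of two white noise laws with means
  \<open>\<theta>\<^sub>0\<close> and \<open>\<theta>\<close> has second moment \<open>exp (n \<parallel>\<theta> - \<theta>\<^sub>0\<parallel>\<^sup>2)\<close>, hence
  \<open>P\<^sub>0(S)\<^sup>2 \<le> exp (n \<parallel>\<theta> - \<theta>\<^sub>0\<parallel>\<^sup>2) P\<^sub>\<theta>(S)\<close>. For events that depend on finitely many coordinates this
  is a computation with densities; it extends to all events because they are approximated by such
  events under both laws (\<open>white_noise_sq_le\<close>). Integrating it over the \<open>\<theta>\<close> with support in
  \<open>{1..k}\<close> whose coordinates are within \<open>1/n\<close> of those of \<open>\<theta>\<^sub>0\<close> gives the bound for \<open>m\<close>: there
  \<open>n \<parallel>\<theta> - \<theta>\<^sub>0\<parallel>\<^sup>2\<close> is at most a multiple of \<open>R\<close>, and the prior mass of these \<open>\<theta>\<close> is at least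
  \<open>exp (- 3 R)\<close> (\<open>sieve_prior_mass_ge\<close>, \<open>marginal_dominates_truth\<close>). This bound on the mass uses
  \<open>q \<le> 1\<close> and \<open>\<beta> \<ge> 1/2\<close>: the Gaussian exponent \<open>\<Sum>\<^sub>j\<^sub>\<le>\<^sub>k \<theta>\<^sub>0\<^sub>j\<^sup>2 j\<^bsup>2q\<^esup>\<close> is at most
  \<open>k \<Sum>\<^sub>j \<theta>\<^sub>0\<^sub>j\<^sup>2 j\<^bsup>2\<beta>\<^esup>\<close>.

  It remains to find an event on which the posterior mass of the far set is small under \<open>m\<close>. Let the
  test reject when the first \<open>N = K k\<close> coordinates of the data are far from those of \<open>\<theta>\<^sub>0\<close>. Under
  \<open>\<theta>\<^sub>0\<close>, and under every far \<open>\<theta>\<close> supported in \<open>{1..N}\<close>, it errs with the small probability of a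
  chi-square tail, and sequences with larger support have small prior mass by the Poisson tail. So the
  \<open>m\<close>-integral of the posterior mass of the far set, over the data that the test accepts, is at most
  \<open>2 exp (- C' R)\<close>, with \<open>C'\<close> as large as desired when \<open>K\<close> and \<open>M\<close> are large. Markov's inequality
  and the transport inequality turn this into a bound under \<open>P\<^sub>0\<close>
  (\<open>posterior_mass_le_of_test\<close>), and for large \<open>n\<close> the expectation is at most \<open>4 / n\<close>, uniformly in
  \<open>\<beta>\<close> and \<open>\<theta>\<^sub>0\<close> (\<open>posterior_contraction_bound\<close>).
\<close>

section \<open>Approximation of events by an algebra\<close>

text \<open>
  The same approximating set has to serve two measures at once. The sets that can be so approximated
  form a sigma algebra: a countable union is first replaced by a finite one, by continuity from
  below.
\<close>
lemma algebra_approximates_sigma_algebra: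
  assumes P: "finite_measure P" and Q: "finite_measure Q"
    and G: "algebra \<Omega> G" and sP: "sets P = sigma_sets \<Omega> G" and sQ: "sets Q = sets P"
    and A: "A \<in> sets P" and e: "e > 0"
  shows "\<exists>B\<in>G. measure P (sym_diff A B) < e \<and> measure Q (sym_diff A B) < e"
proof -
  interpret P: finite_measure P by fact
  interpret Q: finite_measure Q by fact
  interpret G: algebra \<Omega> G by fact
  have GP: "B \<in> sets P" if "B \<in> G" for B
    using that by (simp add: sP sigma_sets.Basic)
  have "A \<in> sigma_sets \<Omega> G" using A sP by simp
  then show ?thesis
    using e
  proof (induction arbitrary: e)
    case (Basic a)
    then show ?case by (intro bexI[of _ a]) auto
  next
    case Empty
    then show ?case by (intro bexI[of _ "{}"]) auto
  next
    case (Compl a)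
    then obtain B where B: "B \<in> G" "measure P (sym_diff a B) < e" "measure Q (sym_diff a B) < e"
      by blast
    have "a \<subseteq> \<Omega>" using Compl.hyps sigma_sets_into_sp G.space_closed by blast
    moreover have "B \<subseteq> \<Omega>" using B G.space_closed by blast
    ultimately have "sym_diff (\<Omega> - a) (\<Omega> - B) = sym_diff a B" by blast
    then show ?case using B by (intro bexI[of _ "\<Omega> - B"]) auto
  next
    case (Union a)
    have am: "a i \<in> sets P" "a i \<in> sets Q" for i
      using Union.hyps sP sQ by auto
    have fin: "\<exists>B\<in>G. measure P (sym_diff (\<Union>i<n. a i) B) < e
                   \<and> measure Q (sym_diff (\<Union>i<n. a i) B) < e" if "e > 0" for e n
      using that
    proof (induction n arbitrary: e)
      case 0
      then show ?case by (intro bexI[of _ "{}"]) auto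
    next
      case (Suc n)
      from Suc.IH[of "e/2"] Suc.prems obtain B where B: "B \<in> G"
          "measure P (sym_diff (\<Union>i<n. a i) B) < e/2" "measure Q (sym_diff (\<Union>i<n. a i) B) < e/2"
        by auto
      from Union.IH[of "e/2" n] Suc.prems obtain C where C: "C \<in> G"
          "measure P (sym_diff (a n) C) < e/2" "measure Q (sym_diff (a n) C) < e/2" by auto
      have sub: "sym_diff (\<Union>i<Suc n. a i) (B \<union> C) \<subseteq> sym_diff (\<Union>i<n. a i) B \<union> sym_diff (a n) C"
        by (auto simp: lessThan_Suc)
      have *: "measure R (sym_diff (\<Union>i<Suc n. a i) (B \<union> C)) < e"
        if "finite_measure R" "sets R = sets P"
          "measure R (sym_diff (\<Union>i<n. a i) B) < e/2" "measure R (sym_diff (a n) C) < e/2" for R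
      proof -
        interpret R: finite_measure R by fact
        have m: "sym_diff (\<Union>i<n. a i) B \<in> sets R" "sym_diff (a n) C \<in> sets R"
          using am GP B C that(2) by (auto intro!: sets.Un sets.Diff sets.finite_UN)
        have "measure R (sym_diff (\<Union>i<Suc n. a i) (B \<union> C))
            \<le> measure R (sym_diff (\<Union>i<n. a i) B \<union> sym_diff (a n) C)"
          by (rule R.finite_measure_mono[OF sub]) (intro sets.Un[OF m])
        also have "\<dots> \<le> measure R (sym_diff (\<Union>i<n. a i) B) + measure R (sym_diff (a n) C)"
          by (rule measure_Un_le[OF m])
        finally show ?thesis using that by simp
      qed
      show ?case
        using *[OF P refl B(2) C(2)] *[OF Q sQ B(3) C(3)] B C by (intro bexI[of _ "B \<union> C"]) auto
    qed
    have lim: "\<forall>\<^sub>F n in sequentially. measure R (\<Union>i. a i) - measure R (\<Union>i<n. a i) < e/2"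
      if "finite_measure R" "sets R = sets P" for R
    proof -
      interpret R: finite_measure R by fact
      have "incseq (\<lambda>n. \<Union>i<n. a i)" by (intro monoI UN_mono) auto
      then have "(\<lambda>n. measure R (\<Union>i<n. a i)) \<longlonglongrightarrow> measure R (\<Union>n. \<Union>i<n. a i)"
        using am that
        by (intro R.finite_Lim_measure_incseq) (auto intro!: sets.finite_UN)
      also have "(\<Union>n. \<Union>i<n. a i) = (\<Union>i. a i)" by blast
      finally have "(\<lambda>n. measure R (\<Union>i. a i) - measure R (\<Union>i<n. a i))
          \<longlonglongrightarrow> measure R (\<Union>i. a i) - measure R (\<Union>i. a i)"
        by (rule tendsto_diff[OF tendsto_const])
      then have "(\<lambda>n. measure R (\<Union>i. a i) - measure R (\<Union>i<n. a i)) \<longlonglongrightarrow> 0"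
        by (simp only: diff_self)
      then show ?thesis using Union.prems by (intro order_tendstoD(2)[of _ 0]) auto
    qed
    from eventually_conj[OF lim[OF P refl] lim[OF Q sQ]] obtain n where n:
      "measure P (\<Union>i. a i) - measure P (\<Union>i<n. a i) < e/2"
      "measure Q (\<Union>i. a i) - measure Q (\<Union>i<n. a i) < e/2"
      by (auto simp: eventually_sequentially)
    from fin[of "e/2" n] Union.prems obtain B where B: "B \<in> G"
        "measure P (sym_diff (\<Union>i<n. a i) B) < e/2" "measure Q (sym_diff (\<Union>i<n. a i) B) < e/2"
      by auto
    have *: "measure R (sym_diff (\<Union>i. a i) B) < e"
      if "finite_measure R" "sets R = sets P"
        "measure R (\<Union>i. a i) - measure R (\<Union>i<n. a i) < e/2"
        "measure R (sym_diff (\<Union>i<n. a i) B) < e/2" for R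
    proof -
      interpret R: finite_measure R by fact
      have m: "(\<Union>i. a i) \<in> sets R" "(\<Union>i<n. a i) \<in> sets R" "B \<in> sets R"
        using am GP B that(2) by (auto intro!: sets.finite_UN)
      have "measure R (sym_diff (\<Union>i. a i) B)
          \<le> measure R (((\<Union>i. a i) - (\<Union>i<n. a i)) \<union> sym_diff (\<Union>i<n. a i) B)"
        using m by (intro R.finite_measure_mono) auto
      also have "\<dots> \<le> measure R ((\<Union>i. a i) - (\<Union>i<n. a i)) + measure R (sym_diff (\<Union>i<n. a i) B)"
        using m by (intro measure_Un_le) auto
      also have "measure R ((\<Union>i. a i) - (\<Union>i<n. a i)) = measure R (\<Union>i. a i) - measure R (\<Union>i<n. a i)"
        using m by (intro R.finite_measure_Diff) auto
      finally show ?thesis using that by simp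
    qed
    show ?case
      using *[OF P refl n(1) B(2)] *[OF Q sQ n(2) B(3)] B by (intro bexI[of _ B]) auto
  qed
qed

text \<open>Both sides are continuous under the approximation above, so the inequality passes to the limit.\<close>
lemma measure_sq_le_from_algebra:
  assumes P: "finite_measure P" and Q: "finite_measure Q"
    and G: "algebra \<Omega> G" and sP: "sets P = sigma_sets \<Omega> G" and sQ: "sets Q = sets P"
    and le: "\<And>B. B \<in> G \<Longrightarrow> (measure P B)\<^sup>2 \<le> C * measure Q B"
    and A: "A \<in> sets P"
  shows "(measure P A)\<^sup>2 \<le> C * measure Q A"
proof -
  have "\<exists>B\<in>G. measure P (sym_diff A B) < 1 / real (Suc k) \<and> measure Q (sym_diff A B) < 1 / real (Suc k)"
    for k by (rule algebra_approximates_sigma_algebra[OF P Q G sP sQ A]) simp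
  then obtain B where B: "\<And>k. B k \<in> G"
      "\<And>k. measure P (sym_diff A (B k)) < 1 / real (Suc k)"
      "\<And>k. measure Q (sym_diff A (B k)) < 1 / real (Suc k)"
    by metis
  have Bm: "B k \<in> sets P" for k using B(1) by (simp add: sP sigma_sets.Basic)
  have lim: "(\<lambda>k. measure R (B k)) \<longlonglongrightarrow> measure R A"
    if "finite_measure R" "sets R = sets P" "\<And>k. measure R (sym_diff A (B k)) < 1 / real (Suc k)" for R
  proof -
    interpret R: finite_measure R by fact
    have m: "A \<in> sets R" "B k \<in> sets R" for k using Bm A that by auto
    have "\<bar>measure R (B k) - measure R A\<bar> \<le> measure R (sym_diff A (B k))" for k
    proof -
      have "measure R A \<le> measure R (B k \<union> sym_diff A (B k))"
        using m by (intro R.finite_measure_mono) auto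
      also have "\<dots> \<le> measure R (B k) + measure R (sym_diff A (B k))"
        using m by (intro measure_Un_le) auto
      finally have 1: "measure R A \<le> measure R (B k) + measure R (sym_diff A (B k))" .
      have "measure R (B k) \<le> measure R (A \<union> sym_diff A (B k))"
        using m by (intro R.finite_measure_mono) auto
      also have "\<dots> \<le> measure R A + measure R (sym_diff A (B k))"
        using m by (intro measure_Un_le) auto
      finally show ?thesis using 1 by linarith
    qed
    then have "\<bar>measure R (B k) - measure R A\<bar> \<le> 1 / real (Suc k)" for k
      using that(3)[of k] by (meson less_eq_real_def order_trans)
    then have "(\<lambda>k. measure R (B k) - measure R A) \<longlonglongrightarrow> 0"
      by (intro Lim_null_comparison[OF _ LIMSEQ_inverse_real_of_nat])
        (auto simp: inverse_eq_divide)
    then show ?thesis by (simp add: LIM_zero_iff)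
  qed
  show ?thesis
    by (rule LIMSEQ_le[OF tendsto_power[OF lim[OF P refl B(2)]]
        tendsto_mult[OF tendsto_const lim[OF Q sQ B(3)]]]) (use le B(1) in auto)
qed

section \<open>Shifts of Gaussian noise\<close>

lemma space_std_gaussian_noise: "space std_gaussian_noise = space seq_borel"
  by (rule sets_eq_imp_space_eq[OF sets_std_gaussian_noise])

abbreviation gaussian_product :: "(nat \<Rightarrow> real) \<Rightarrow> (nat \<Rightarrow> real) measure" where
  "gaussian_product h \<equiv> Pi\<^sub>M {1..} (\<lambda>j. density lborel (normal_density (h j) 1))"

text \<open>The one-dimensional Cameron-Martin density.\<close>
lemma density_normal_shift:
  "density lborel (normal_density h 1)
     = density (density lborel std_normal_density) (\<lambda>x. ennreal (exp (h * x - h\<^sup>2 / 2)))"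
proof -
  have *: "normal_density h 1 x = std_normal_density x * exp (h * x - h\<^sup>2 / 2)" for x
    by (simp add: normal_density_def exp_add[symmetric]) (simp add: power2_eq_square field_simps)
  show ?thesis
    by (subst density_density_eq) (auto simp: * ennreal_mult)
qed

lemma distr_std_normal_shift:
  "distr (density lborel std_normal_density) borel (\<lambda>x. x + h) = density lborel (normal_density h 1)"
proof -
  have "density lborel (normal_density h 1) = density (distr lborel borel (\<lambda>x. x + h)) (normal_density h 1)"
    using lborel_distr_plus[of h] by (simp add: add.commute[of _ h])
  also have "\<dots> = distr (density lborel (\<lambda>x. normal_density h 1 (x + h))) borel (\<lambda>x. x + h)"
    by (subst density_distr) auto
  also have "(\<lambda>x. normal_density h 1 (x + h)) = std_normal_density"
    by (simp add: normal_density_def fun_eq_iff)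
  finally show ?thesis by simp
qed

lemma product_prob_space_gaussian:
  "product_prob_space (\<lambda>j::nat. density lborel (normal_density (h j) 1))"
proof -
  interpret prob_space "density lborel (normal_density (h j) 1)" for j
    by (rule prob_space_normal_density) simp
  show ?thesis by unfold_locales
qed

text \<open>
  The two laws are compared on finite-dimensional boxes, because the shift \<open>h\<close> is arbitrary and a
  density with respect to the noise exists only if \<open>h\<close> is square-summable.
\<close>
lemma emeasure_noise_shift:
  assumes A: "A \<in> sets seq_borel"
  shows "emeasure std_gaussian_noise {\<xi>\<in>space seq_borel. (\<lambda>j\<in>{1..}. \<xi> j + h j) \<in> A}
       = emeasure (gaussian_product h) A"
proof -
  interpret N: product_prob_space "\<lambda>j::nat. density lborel (normal_density (h j) 1)" "{1..}"
    by (rule product_prob_space_gaussian)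
  interpret S: product_prob_space "\<lambda>j::nat. density lborel std_normal_density" "{1..}"
    using product_prob_space_gaussian[of "\<lambda>_. 0"] .
  have m [measurable]: "(\<lambda>\<xi>. \<lambda>j\<in>{1..}. \<xi> j + h j) \<in> std_gaussian_noise \<rightarrow>\<^sub>M seq_borel"
    by (subst measurable_cong_sets[OF sets_std_gaussian_noise refl]) measurable
  have "distr std_gaussian_noise seq_borel (\<lambda>\<xi>. \<lambda>j\<in>{1..}. \<xi> j + h j) = gaussian_product h"
  proof (rule N.PiM_eq)
    show "sets (distr std_gaussian_noise seq_borel (\<lambda>\<xi>. \<lambda>j\<in>{1..}. \<xi> j + h j)) = sets (gaussian_product h)"
      by (auto intro!: sets_PiM_cong)
  next
    fix J :: "nat set" and F
    assume J: "finite J" "J \<subseteq> {1..}"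
      and F: "\<And>j. j \<in> J \<Longrightarrow> F j \<in> sets (density lborel (normal_density (h j) 1))"
    let ?E = "prod_emb {1..} (\<lambda>j. density lborel (normal_density (h j) 1)) J (Pi\<^sub>E J F)"
    have pre: "(\<lambda>x. x + h j) -` F j \<in> sets borel" if "j \<in> J" for j
      using measurable_sets[of "\<lambda>x. x + h j" borel borel "F j"] F[OF that] by simp
    have Eq: "?E = {x\<in>space seq_borel. \<forall>j\<in>J. x j \<in> F j}"
      using J F by (auto simp: prod_emb_def space_PiM Pi_iff)
    have E: "?E \<in> sets seq_borel"
      unfolding Eq using J F by (intro sets.sets_Collect_finite_All sets_Collect_single') auto
    have "(\<lambda>\<xi>. \<lambda>j\<in>{1..}. \<xi> j + h j) -` ?E \<inter> space std_gaussian_noise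
        = {\<xi>\<in>space std_gaussian_noise. \<forall>j\<in>J. \<xi> j \<in> (\<lambda>x. x + h j) -` F j}"
      unfolding Eq using measurable_space[OF m] J(2) by (auto simp: subset_eq)
    then have "emeasure (distr std_gaussian_noise seq_borel (\<lambda>\<xi>. \<lambda>j\<in>{1..}. \<xi> j + h j)) ?E
        = emeasure std_gaussian_noise {\<xi>\<in>space std_gaussian_noise. \<forall>j\<in>J. \<xi> j \<in> (\<lambda>x. x + h j) -` F j}"
      by (subst emeasure_distr[OF m E]) simp
    also have "\<dots> = (\<Prod>j\<in>J. emeasure (density lborel std_normal_density) ((\<lambda>x. x + h j) -` F j))"
      unfolding std_gaussian_noise_def
      using J pre by (intro S.emeasure_PiM_Collect) auto
    also have "\<dots> = (\<Prod>j\<in>J. emeasure (density lborel (normal_density (h j) 1)) (F j))"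
    proof (intro prod.cong refl)
      fix j assume "j \<in> J"
      then show "emeasure (density lborel std_normal_density) ((\<lambda>x. x + h j) -` F j)
          = emeasure (density lborel (normal_density (h j) 1)) (F j)"
        using F by (subst distr_std_normal_shift[of "h j", symmetric], subst emeasure_distr) auto
    qed
    finally show "emeasure (distr std_gaussian_noise seq_borel (\<lambda>\<xi>. \<lambda>j\<in>{1..}. \<xi> j + h j)) ?E
      = (\<Prod>j\<in>J. emeasure (density lborel (normal_density (h j) 1)) (F j))" .
  qed
  then have "emeasure (gaussian_product h) A
      = emeasure (distr std_gaussian_noise seq_borel (\<lambda>\<xi>. \<lambda>j\<in>{1..}. \<xi> j + h j)) A" by simp
  also have "\<dots> = emeasure std_gaussian_noise {\<xi>\<in>space seq_borel. (\<lambda>j\<in>{1..}. \<xi> j + h j) \<in> A}"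
    by (subst emeasure_distr[OF m A]) (auto intro!: arg_cong[where f="emeasure std_gaussian_noise"] simp: space_std_gaussian_noise)
  finally show ?thesis by simp
qed

text \<open>
  Completing the square: density times squared likelihood ratio is \<open>exp (h\<^sup>2)\<close> times the density of
  the normal law with mean \<open>2 h\<close>.
\<close>
lemma normal_likelihood_sq:
  "(\<integral>\<^sup>+x. (ennreal (exp (h * x - h\<^sup>2 / 2)))\<^sup>2 \<partial>density lborel std_normal_density) = ennreal (exp (h\<^sup>2))"
proof -
  have *: "std_normal_density x * (exp (h * x - h\<^sup>2 / 2))\<^sup>2 = exp (h\<^sup>2) * normal_density (2 * h) 1 x" for x
    by (simp add: normal_density_def exp_add[symmetric] exp_double[symmetric])
      (simp add: power2_eq_square field_simps)
  have "(\<integral>\<^sup>+x. (ennreal (exp (h * x - h\<^sup>2 / 2)))\<^sup>2 \<partial>density lborel std_normal_density)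
      = (\<integral>\<^sup>+x. ennreal (exp (h\<^sup>2)) * ennreal (normal_density (2 * h) 1 x) \<partial>lborel)"
    by (subst nn_integral_density) (auto simp: ennreal_power ennreal_mult[symmetric] *)
  also have "\<dots> = ennreal (exp (h\<^sup>2)) * ennreal (\<integral>x. normal_density (2 * h) 1 x \<partial>lborel)"
    by (subst nn_integral_cmult, simp, subst nn_integral_eq_integral) auto
  finally show ?thesis by simp
qed

text \<open>
  The shifted law has the product of the one-dimensional likelihood ratios as density. Cauchy-Schwarz
  against the indicator of the event leaves the second moment of that product.
\<close>
lemma finite_gaussian_product_sq_le:
  fixes h :: "nat \<Rightarrow> real"
  assumes J: "finite J" and E: "E \<in> sets (Pi\<^sub>M J (\<lambda>_. borel))"
  shows "(emeasure (Pi\<^sub>M J (\<lambda>j. density lborel (normal_density (h j) 1))) E)\<^sup>2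
     \<le> ennreal (exp (\<Sum>j\<in>J. (h j)\<^sup>2)) * emeasure (Pi\<^sub>M J (\<lambda>j. density lborel std_normal_density)) E"
proof -
  let ?S = "\<lambda>j::nat. density lborel std_normal_density"
  let ?N = "\<lambda>j. density lborel (normal_density (h j) 1)"
  let ?w = "\<lambda>x. \<Prod>j\<in>J. ennreal (exp (h j * x j - (h j)\<^sup>2 / 2))"
  interpret N: product_prob_space ?N J
    by (rule product_prob_space_gaussian)
  interpret S: product_prob_space ?S J
    using product_prob_space_gaussian[of "\<lambda>_. 0"] .
  have sS [measurable_cong]: "sets (Pi\<^sub>M J ?S) = sets (Pi\<^sub>M J (\<lambda>_. borel))"
    and sN: "sets (Pi\<^sub>M J ?N) = sets (Pi\<^sub>M J (\<lambda>_. borel))"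
    by (intro sets_PiM_cong; simp)+
  have w [measurable]: "?w \<in> borel_measurable (Pi\<^sub>M J ?S)"
    by measurable
  have "density (Pi\<^sub>M J ?S) ?w = Pi\<^sub>M J ?N"
  proof (rule N.PiM_eqI[OF J])
    show "sets (density (Pi\<^sub>M J ?S) ?w) = sets (Pi\<^sub>M J ?N)" using sS sN by simp
    fix A assume A: "\<And>i. i \<in> J \<Longrightarrow> A i \<in> sets (?N i)"
    then have Ab [measurable]: "\<And>i. i \<in> J \<Longrightarrow> A i \<in> sets borel" by simp
    have box: "Pi\<^sub>E J A \<in> sets (Pi\<^sub>M J ?S)"
      using J A by (intro sets_PiM_I_finite) auto
    have "emeasure (density (Pi\<^sub>M J ?S) ?w) (Pi\<^sub>E J A)
        = (\<integral>\<^sup>+x. ?w x * indicator (Pi\<^sub>E J A) x \<partial>Pi\<^sub>M J ?S)"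
      by (rule emeasure_density[OF w box])
    also have "\<dots> = (\<integral>\<^sup>+x. (\<Prod>j\<in>J. ennreal (exp (h j * x j - (h j)\<^sup>2 / 2)) * indicator (A j) (x j)) \<partial>Pi\<^sub>M J ?S)"
    proof (intro nn_integral_cong)
      fix x assume "x \<in> space (Pi\<^sub>M J ?S)"
      then have ext: "x \<in> extensional J" by (simp add: space_PiM PiE_def)
      have "indicator (Pi\<^sub>E J A) x = (\<Prod>j\<in>J. indicator (A j) (x j) :: ennreal)"
      proof (cases "\<forall>j\<in>J. x j \<in> A j")
        case True
        then show ?thesis using ext by (simp add: PiE_iff)
      next
        case False
        then obtain j where "j \<in> J" "x j \<notin> A j" by blast
        then have "(\<Prod>j\<in>J. indicator (A j) (x j) :: ennreal) = 0" using J
          by (intro prod_zero bexI[of _ j]) auto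
        then show ?thesis using False by (simp add: PiE_iff)
      qed
      then show "?w x * indicator (Pi\<^sub>E J A) x
        = (\<Prod>j\<in>J. ennreal (exp (h j * x j - (h j)\<^sup>2 / 2)) * indicator (A j) (x j))"
        by (simp add: prod.distrib)
    qed
    also have "\<dots> = (\<Prod>j\<in>J. \<integral>\<^sup>+x. ennreal (exp (h j * x - (h j)\<^sup>2 / 2)) * indicator (A j) x \<partial>?S j)"
      using J Ab by (intro S.product_nn_integral_prod) auto
    also have "\<dots> = (\<Prod>j\<in>J. emeasure (?N j) (A j))"
    proof (intro prod.cong refl)
      fix j assume "j \<in> J"
      then show "(\<integral>\<^sup>+x. ennreal (exp (h j * x - (h j)\<^sup>2 / 2)) * indicator (A j) x \<partial>?S j) = emeasure (?N j) (A j)"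
        by (subst density_normal_shift[of "h j"], subst emeasure_density) auto
    qed
    finally show "emeasure (density (Pi\<^sub>M J ?S) ?w) (Pi\<^sub>E J A) = (\<Prod>j\<in>J. emeasure (?N j) (A j))" .
  qed
  then have "emeasure (Pi\<^sub>M J ?N) E = emeasure (density (Pi\<^sub>M J ?S) ?w) E"
    by simp
  also have "\<dots> = (\<integral>\<^sup>+x. ?w x * indicator E x \<partial>Pi\<^sub>M J ?S)"
    using E sS by (intro emeasure_density[OF w]) simp
  finally have "(emeasure (Pi\<^sub>M J ?N) E)\<^sup>2 = (\<integral>\<^sup>+x. ?w x * indicator E x \<partial>Pi\<^sub>M J ?S)\<^sup>2"
    by (rule arg_cong)
  also have "\<dots> \<le> (\<integral>\<^sup>+x. (?w x)\<^sup>2 \<partial>Pi\<^sub>M J ?S) * (\<integral>\<^sup>+x. (indicator E x)\<^sup>2 \<partial>Pi\<^sub>M J ?S)"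
    using E sS by (intro Cauchy_Schwarz_nn_integral w borel_measurable_indicator) auto
  also have "(\<integral>\<^sup>+x. (indicator E x :: ennreal)\<^sup>2 \<partial>Pi\<^sub>M J ?S) = emeasure (Pi\<^sub>M J ?S) E"
  proof -
    have "(\<integral>\<^sup>+x. (indicator E x :: ennreal)\<^sup>2 \<partial>Pi\<^sub>M J ?S) = (\<integral>\<^sup>+x. indicator E x \<partial>Pi\<^sub>M J ?S)"
      by (intro nn_integral_cong) (simp add: indicator_def)
    then show ?thesis using E sS by (simp only: nn_integral_indicator)
  qed
  also have "(\<integral>\<^sup>+x. (?w x)\<^sup>2 \<partial>Pi\<^sub>M J ?S)
      = (\<Prod>j\<in>J. \<integral>\<^sup>+x. (ennreal (exp (h j * x - (h j)\<^sup>2 / 2)))\<^sup>2 \<partial>?S j)"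
    unfolding prod_power_distrib using J by (intro S.product_nn_integral_prod) auto
  also have "\<dots> = ennreal (exp (\<Sum>j\<in>J. (h j)\<^sup>2))"
    unfolding normal_likelihood_sq using J by (simp add: prod_ennreal exp_sum)
  finally show ?thesis .
qed


text \<open>The exact value is \<open>\<surd>2\<close>.\<close>
lemma nn_integral_exp_quarter_sq:
  "(\<integral>\<^sup>+x. ennreal (exp (x\<^sup>2 / 4)) \<partial>density lborel std_normal_density) \<le> 2"
proof -
  have *: "std_normal_density x * exp (x\<^sup>2 / 4) = sqrt 2 * normal_density 0 (sqrt 2) x" for x
    by (simp add: normal_density_def exp_add[symmetric] real_sqrt_mult)
      (simp add: power2_eq_square field_simps)
  have "(\<integral>\<^sup>+x. ennreal (exp (x\<^sup>2 / 4)) \<partial>density lborel std_normal_density)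
      = (\<integral>\<^sup>+x. ennreal (sqrt 2) * ennreal (normal_density 0 (sqrt 2) x) \<partial>lborel)"
    by (subst nn_integral_density) (auto simp: ennreal_mult[symmetric] *)
  also have "\<dots> = ennreal (sqrt 2) * ennreal (\<integral>x. normal_density 0 (sqrt 2) x \<partial>lborel)"
    by (subst nn_integral_cmult, simp, subst nn_integral_eq_integral) auto
  also have "\<dots> \<le> 2"
    by (simp add: sqrt2_less_2 less_imp_le)
  finally show ?thesis .
qed

text \<open>Chernoff's bound with exponent \<open>1/4\<close>, for which each coordinate contributes a factor of at most 2.\<close>
lemma chi_square_tail:
  "emeasure std_gaussian_noise {\<xi>\<in>space seq_borel. t \<le> (\<Sum>j=1..m. (\<xi> j)\<^sup>2)}
     \<le> ennreal (2 ^ m * exp (- t / 4))"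
proof -
  let ?S = "\<lambda>j::nat. density lborel std_normal_density"
  let ?J = "{1..m}"
  interpret S: product_prob_space ?S "{1..}"
    using product_prob_space_gaussian[of "\<lambda>_. 0"] .
  have meas: "(\<lambda>\<xi>. \<Prod>j\<in>?J. ennreal (exp ((\<xi> j)\<^sup>2 / 4))) \<in> borel_measurable std_gaussian_noise"
    by (subst measurable_cong_sets[OF sets_std_gaussian_noise refl]) measurable
  have "emeasure std_gaussian_noise {\<xi>\<in>space seq_borel. t \<le> (\<Sum>j=1..m. (\<xi> j)\<^sup>2)}
      = (\<integral>\<^sup>+\<xi>. indicator {\<xi>\<in>space seq_borel. t \<le> (\<Sum>j=1..m. (\<xi> j)\<^sup>2)} \<xi> \<partial>std_gaussian_noise)"
    by (subst nn_integral_indicator) (simp_all add: sets_std_gaussian_noise)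
  also have "\<dots> \<le> (\<integral>\<^sup>+\<xi>. ennreal (exp (- t / 4)) * (\<Prod>j\<in>?J. ennreal (exp ((\<xi> j)\<^sup>2 / 4))) \<partial>std_gaussian_noise)"
  proof (intro nn_integral_mono)
    fix \<xi> :: "nat \<Rightarrow> real"
    have "ennreal (exp (- t / 4)) * (\<Prod>j\<in>?J. ennreal (exp ((\<xi> j)\<^sup>2 / 4)))
        = ennreal (exp (((\<Sum>j=1..m. (\<xi> j)\<^sup>2) - t) / 4))"
    proof -
      have "(\<Prod>j\<in>?J. ennreal (exp ((\<xi> j)\<^sup>2 / 4))) = ennreal (exp ((\<Sum>j=1..m. (\<xi> j)\<^sup>2) / 4))"
        by (subst prod_ennreal) (simp_all add: exp_sum sum_divide_distrib)
      then show ?thesis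
        by (simp only: ennreal_mult[symmetric] exp_ge_zero exp_add[symmetric]) (simp add: diff_divide_distrib)
    qed
    moreover have "1 \<le> exp (((\<Sum>j=1..m. (\<xi> j)\<^sup>2) - t) / 4)" if "t \<le> (\<Sum>j=1..m. (\<xi> j)\<^sup>2)"
      using that by simp
    ultimately show "indicator {\<xi>\<in>space seq_borel. t \<le> (\<Sum>j=1..m. (\<xi> j)\<^sup>2)} \<xi>
       \<le> ennreal (exp (- t / 4)) * (\<Prod>j\<in>?J. ennreal (exp ((\<xi> j)\<^sup>2 / 4)))"
      by (auto simp: indicator_def)
  qed
  also have "\<dots> = ennreal (exp (- t / 4)) * (\<integral>\<^sup>+\<xi>. (\<Prod>j\<in>?J. ennreal (exp ((\<xi> j)\<^sup>2 / 4))) \<partial>std_gaussian_noise)"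
    by (intro nn_integral_cmult meas)
  finally have markov: "emeasure std_gaussian_noise {\<xi>\<in>space seq_borel. t \<le> (\<Sum>j=1..m. (\<xi> j)\<^sup>2)}
      \<le> ennreal (exp (- t / 4)) * (\<integral>\<^sup>+\<xi>. (\<Prod>j\<in>?J. ennreal (exp ((\<xi> j)\<^sup>2 / 4))) \<partial>std_gaussian_noise)" .
  have marginal: "distr std_gaussian_noise (Pi\<^sub>M ?J ?S) (\<lambda>\<xi>. restrict \<xi> ?J) = Pi\<^sub>M ?J ?S"
    unfolding std_gaussian_noise_def by (rule S.distr_PiM_restrict_finite) auto
  have "(\<integral>\<^sup>+\<xi>. (\<Prod>j\<in>?J. ennreal (exp ((\<xi> j)\<^sup>2 / 4))) \<partial>std_gaussian_noise)
      = (\<integral>\<^sup>+\<xi>. (\<Prod>j\<in>?J. ennreal (exp ((\<xi> j)\<^sup>2 / 4))) \<partial>Pi\<^sub>M ?J ?S)"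
    by (subst marginal[symmetric], subst nn_integral_distr)
      (auto simp: std_gaussian_noise_def intro!: measurable_restrict_subset)
  also have "\<dots> = (\<Prod>j\<in>?J. \<integral>\<^sup>+x. ennreal (exp (x\<^sup>2 / 4)) \<partial>?S j)"
    by (intro S.product_nn_integral_prod) auto
  also have "\<dots> \<le> (\<Prod>j\<in>?J. 2)"
    by (intro prod_mono_ennreal nn_integral_exp_quarter_sq)
  also have "\<dots> = ennreal (2 ^ m)" using ennreal_power[of 2 m] by simp
  finally have "ennreal (exp (- t / 4)) * (\<integral>\<^sup>+\<xi>. (\<Prod>j\<in>?J. ennreal (exp ((\<xi> j)\<^sup>2 / 4))) \<partial>std_gaussian_noise)
      \<le> ennreal (exp (- t / 4)) * ennreal (2 ^ m)"
    by (intro mult_left_mono) auto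
  also have "\<dots> = ennreal (2 ^ m * exp (- t / 4))"
    by (simp add: ennreal_mult mult.commute)
  finally show ?thesis using markov by (rule order_trans[rotated])
qed

text \<open>
  For cylinder events the bound is the finite-dimensional one, with a constant that does not depend on
  the number of coordinates; cylinders form an algebra that generates the product sigma algebra. In
  particular the shifted law is absolutely continuous.
\<close>
lemma noise_shift_sq_le:
  assumes A: "A \<in> sets seq_borel" and D: "\<And>m. (\<Sum>j=1..m. (h j)\<^sup>2) \<le> D"
  shows "(emeasure std_gaussian_noise {\<xi>\<in>space seq_borel. (\<lambda>j\<in>{1..}. \<xi> j + h j) \<in> A})\<^sup>2
    \<le> ennreal (exp D) * emeasure std_gaussian_noise A"
proof -
  let ?S = "\<lambda>j::nat. density lborel std_normal_density"
  let ?N = "\<lambda>j. density lborel (normal_density (h j) 1)"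
  interpret N: product_prob_space ?N "{1..}"
    by (rule product_prob_space_gaussian)
  interpret S: product_prob_space ?S "{1..}"
    using product_prob_space_gaussian[of "\<lambda>_. 0"] .
  have sS: "sets (Pi\<^sub>M {1..} ?S) = sets (Pi\<^sub>M {1..} ?N)"
    and sN: "sets (Pi\<^sub>M {1..} ?N) = sets seq_borel"
    by (intro sets_PiM_cong; simp)+
  have "(measure (Pi\<^sub>M {1..} ?N) A)\<^sup>2 \<le> exp D * measure (Pi\<^sub>M {1..} ?S) A"
  proof (rule measure_sq_le_from_algebra[OF _ _ N.algebra_generator N.sets_PiM_generator sS])
    fix B assume "B \<in> N.generator"
    then obtain J X where J: "finite J" "J \<subseteq> {1..}" and X: "X \<in> sets (Pi\<^sub>M J ?N)"
      and B: "B = prod_emb {1..} ?N J X"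
      by (elim N.generator.cases) blast
    have BS: "B = prod_emb {1..} ?S J X"
      unfolding B by (simp add: prod_emb_def)
    have sJ: "sets (Pi\<^sub>M J ?N) = sets (Pi\<^sub>M J (\<lambda>_. borel))" "sets (Pi\<^sub>M J ?S) = sets (Pi\<^sub>M J (\<lambda>_. borel))"
      by (intro sets_PiM_cong; simp)+
    obtain m where m: "J \<subseteq> {1..m}"
      using J finite_nat_set_iff_bounded_le[of J] by (force simp: subset_eq)
    have "(\<Sum>j\<in>J. (h j)\<^sup>2) \<le> (\<Sum>j=1..m. (h j)\<^sup>2)"
      by (rule sum_mono2) (use m in auto)
    with D[of m] have DJ: "exp (\<Sum>j\<in>J. (h j)\<^sup>2) \<le> exp D" by simp
    have "(emeasure (Pi\<^sub>M {1..} ?N) B)\<^sup>2 = (emeasure (Pi\<^sub>M J ?N) X)\<^sup>2"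
      unfolding B using J X by (simp only: N.emeasure_PiM_emb')
    also have "\<dots> \<le> ennreal (exp (\<Sum>j\<in>J. (h j)\<^sup>2)) * emeasure (Pi\<^sub>M J ?S) X"
      by (rule finite_gaussian_product_sq_le) (use J X sJ in auto)
    also have "emeasure (Pi\<^sub>M J ?S) X = emeasure (Pi\<^sub>M {1..} ?S) B"
      unfolding BS using J X sJ by (simp only: S.emeasure_PiM_emb')
    also have "ennreal (exp (\<Sum>j\<in>J. (h j)\<^sup>2)) * emeasure (Pi\<^sub>M {1..} ?S) B
        \<le> ennreal (exp D) * emeasure (Pi\<^sub>M {1..} ?S) B"
      by (intro mult_right_mono ennreal_leI DJ) auto
    finally show "(measure (Pi\<^sub>M {1..} ?N) B)\<^sup>2 \<le> exp D * measure (Pi\<^sub>M {1..} ?S) B"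
      by (simp add: N.P.emeasure_eq_measure S.P.emeasure_eq_measure ennreal_power
          ennreal_mult[symmetric] del: One_nat_def)
  qed (use A sN N.P.finite_measure_axioms S.P.finite_measure_axioms in auto)
  then show ?thesis
    unfolding emeasure_noise_shift[OF A] unfolding std_gaussian_noise_def
    by (simp add: N.P.emeasure_eq_measure S.P.emeasure_eq_measure ennreal_power
        ennreal_mult[symmetric] del: One_nat_def)
qed

section \<open>The white noise experiment\<close>

lemma measurable_observation:
  "(\<lambda>\<xi>. \<lambda>j\<in>{1..}. \<theta> j + 1 / sqrt (real n) * \<xi> j) \<in> std_gaussian_noise \<rightarrow>\<^sub>M seq_borel"
  by (subst measurable_cong_sets[OF sets_std_gaussian_noise refl]) measurable

lemma emeasure_white_noise:
  assumes "A \<in> sets seq_borel"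
  shows "emeasure (white_noise n \<theta>) A
     = emeasure std_gaussian_noise {\<xi>\<in>space seq_borel. (\<lambda>j\<in>{1..}. \<theta> j + 1 / sqrt (real n) * \<xi> j) \<in> A}"
  unfolding white_noise_def
  by (subst emeasure_distr[OF measurable_observation assms])
    (auto intro!: arg_cong[where f="emeasure std_gaussian_noise"] simp: space_std_gaussian_noise)

text \<open>
  Moving the mean from \<open>\<theta>\<close> to \<open>\<theta>\<^sub>0\<close> is the same as shifting the noise by
  \<open>\<surd>n (\<theta>\<^sub>0 - \<theta>)\<close>.
\<close>
lemma white_noise_sq_le:
  assumes n: "n \<ge> 1" and A: "A \<in> sets seq_borel"
    and D: "\<And>m. (\<Sum>j=1..m. (\<theta>0 j - \<theta> j)\<^sup>2) \<le> D"
  shows "(emeasure (white_noise n \<theta>0) A)\<^sup>2 \<le> ennreal (exp (real n * D)) * emeasure (white_noise n \<theta>) A"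
proof -
  define A' where "A' = {\<xi>\<in>space seq_borel. (\<lambda>j\<in>{1..}. \<theta> j + 1 / sqrt (real n) * \<xi> j) \<in> A}"
  define h where "h = (\<lambda>j. sqrt (real n) * (\<theta>0 j - \<theta> j))"
  have A': "A' \<in> sets seq_borel"
    using measurable_sets[OF measurable_observation A, of \<theta> n]
    by (simp add: A'_def vimage_def Int_def conj_commute sets_std_gaussian_noise space_std_gaussian_noise)
  have shift: "\<theta> j + 1 / sqrt (real n) * (\<xi> j + h j) = \<theta>0 j + 1 / sqrt (real n) * \<xi> j" for \<xi> j
    using n by (simp add: h_def field_simps)
  have "{\<xi>\<in>space seq_borel. (\<lambda>j\<in>{1..}. \<xi> j + h j) \<in> A'}
     = {\<xi>\<in>space seq_borel. (\<lambda>j\<in>{1..}. \<theta>0 j + 1 / sqrt (real n) * \<xi> j) \<in> A}"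
  proof -
    have "(\<lambda>j\<in>{1..}. \<xi> j + h j) \<in> space seq_borel" for \<xi>
      by (simp add: space_PiM)
    moreover have "(\<lambda>j\<in>{1..}. \<theta> j + 1 / sqrt (real n) * (\<lambda>j\<in>{1..}. \<xi> j + h j) j)
        = (\<lambda>j\<in>{1..}. \<theta>0 j + 1 / sqrt (real n) * \<xi> j)" for \<xi>
      using shift[of _ \<xi>] by (intro restrict_ext) simp
    ultimately show ?thesis unfolding A'_def by simp
  qed
  moreover have "(\<Sum>j=1..m. (h j)\<^sup>2) \<le> real n * D" for m
    using mult_left_mono[OF D[of m], of "real n"]
    by (simp add: h_def power_mult_distrib sum_distrib_left)
  ultimately show ?thesis
    using noise_shift_sq_le[OF A', of h "real n * D"]
    by (simp add: emeasure_white_noise[OF A] A'_def)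
qed

lemma white_noise_tail:
  assumes n: "n \<ge> 1"
  shows "emeasure (white_noise n \<theta>) {x\<in>space seq_borel. s \<le> (\<Sum>j=1..m. (x j - \<theta> j)\<^sup>2)}
     \<le> ennreal (2 ^ m * exp (- (real n * s) / 4))"
proof -
  have "{\<xi>\<in>space seq_borel. (\<lambda>j\<in>{1..}. \<theta> j + 1 / sqrt (real n) * \<xi> j)
          \<in> {x\<in>space seq_borel. s \<le> (\<Sum>j=1..m. (x j - \<theta> j)\<^sup>2)}}
      = {\<xi>\<in>space seq_borel. real n * s \<le> (\<Sum>j=1..m. (\<xi> j)\<^sup>2)}"
  proof -
    have "(\<Sum>j=1..m. ((\<lambda>j\<in>{1..}. \<theta> j + 1 / sqrt (real n) * \<xi> j) j - \<theta> j)\<^sup>2)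
        = (\<Sum>j=1..m. (\<xi> j)\<^sup>2) / real n" for \<xi>
      unfolding sum_divide_distrib by (intro sum.cong) (auto simp: power_divide)
    then show ?thesis using n by (auto simp: space_PiM pos_le_divide_eq mult.commute simp del: One_nat_def)
  qed
  then show ?thesis
    using chi_square_tail[of "real n * s" m] by (subst emeasure_white_noise) auto
qed

lemma white_noise_prob: "\<theta> \<in> space seq_borel \<Longrightarrow> prob_space (white_noise n \<theta>)"
  and sets_white_noise: "\<theta> \<in> space seq_borel \<Longrightarrow> sets (white_noise n \<theta>) = sets seq_borel"
  using measurable_space[OF white_noise_kernel] by (auto simp: space_prob_algebra)

lemma measurable_white_noise_emeasure:
  "S \<in> sets seq_borel \<Longrightarrow> (\<lambda>\<theta>. emeasure (white_noise n \<theta>) S) \<in> borel_measurable seq_borel"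
  by (rule measurable_compose[OF measurable_prob_algebraD[OF white_noise_kernel]
        measurable_emeasure_subprob_algebra])

section \<open>Posterior mass from a test and a comparison with the marginal law\<close>

text \<open>
  \<open>A\<close> is the rejection region of a test and \<open>\<eta>\<close> bounds its prior-averaged error of the second kind
  on \<open>B\<close>, which by the defining equation of the posterior is the marginal integral of the posterior
  mass of \<open>B\<close> over the acceptance region. By Markov's inequality that mass exceeds \<open>\<delta>\<close> on a set of
  marginal probability at most \<open>\<eta> / \<delta>\<close>, and \<open>dom\<close> bounds the \<open>P0\<close>-probability of this set. The
  hypothesis \<open>dom\<close> also makes \<open>P0\<close> absolutely continuous with respect to the marginal law, so that the
  left side does not depend on the version of the posterior.
\<close>
lemma posterior_mass_le_of_test:
  assumes post: "is_posterior T X \<mu> P \<kappa>"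
    and P0: "prob_space P0" and sP0: "sets P0 = sets X"
    and C: "C \<ge> 0"
    and dom: "\<And>S. S \<in> sets X \<Longrightarrow> (emeasure P0 S)\<^sup>2 \<le> ennreal C * emeasure (\<mu> \<bind> P) S"
    and sM: "sets (\<mu> \<bind> P) = sets X"
    and B: "B \<in> sets T" and A: "A \<in> sets X"
    and err: "(\<integral>\<^sup>+\<theta>\<in>B. emeasure (P \<theta>) (space X - A) \<partial>\<mu>) \<le> ennreal \<eta>"
    and \<eta>: "\<eta> \<ge> 0" and \<delta>: "\<delta> > 0"
  shows "(\<integral>\<^sup>+x. emeasure (\<kappa> x) B \<partial>P0) \<le> emeasure P0 A + ennreal \<delta> + ennreal (sqrt (C * (\<eta> / \<delta>)))"
proof -
  interpret P0: prob_space P0 by fact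
  have \<kappa>: "\<kappa> \<in> X \<rightarrow>\<^sub>M prob_algebra T"
    and eq: "\<And>A B. A \<in> sets X \<Longrightarrow> B \<in> sets T \<Longrightarrow>
        (\<integral>\<^sup>+ x\<in>A. emeasure (\<kappa> x) B \<partial>(\<mu> \<bind> P)) = (\<integral>\<^sup>+ \<theta>\<in>B. emeasure (P \<theta>) A \<partial>\<mu>)"
    using post by (auto simp: is_posterior_def)
  have km: "(\<lambda>x. emeasure (\<kappa> x) B) \<in> borel_measurable X"
    by (rule measurable_compose[OF measurable_prob_algebraD[OF \<kappa>] measurable_emeasure_subprob_algebra[OF B]])
  have km0 [measurable]: "(\<lambda>x. emeasure (\<kappa> x) B) \<in> borel_measurable P0"
    using km sP0 by (simp cong: measurable_cong_sets)
  have sp: "space P0 = space X" "space (\<mu> \<bind> P) = space X"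
    using sP0 sM by (auto dest: sets_eq_imp_space_eq)
  have k1: "emeasure (\<kappa> x) B \<le> 1" if "x \<in> space X" for x
  proof -
    have "prob_space (\<kappa> x)" using measurable_space[OF \<kappa> that] by (simp add: space_prob_algebra)
    then interpret prob_space "\<kappa> x" .
    show ?thesis by (rule emeasure_le_1)
  qed
  define S where "S = {x\<in>space X - A. ennreal \<delta> < emeasure (\<kappa> x) B}"
  have S: "S \<in> sets X"
  proof -
    have "{x\<in>space X. ennreal \<delta> < emeasure (\<kappa> x) B} \<in> sets X"
      using km by measurable
    then have "{x\<in>space X. ennreal \<delta> < emeasure (\<kappa> x) B} - A \<in> sets X" using A by auto
    also have "{x\<in>space X. ennreal \<delta> < emeasure (\<kappa> x) B} - A = S" by (auto simp: S_def)
    finally show ?thesis .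
  qed
  have "ennreal \<delta> * emeasure (\<mu> \<bind> P) S = (\<integral>\<^sup>+x. ennreal \<delta> * indicator S x \<partial>(\<mu> \<bind> P))"
    using S sM by (simp add: nn_integral_cmult_indicator)
  also have "\<dots> \<le> (\<integral>\<^sup>+ x\<in>space X - A. emeasure (\<kappa> x) B \<partial>(\<mu> \<bind> P))"
    by (intro nn_integral_mono) (auto simp: S_def indicator_def)
  also have "\<dots> \<le> ennreal \<eta>"
    using A B err by (subst eq) auto
  finally have "ennreal (1 / \<delta>) * (ennreal \<delta> * emeasure (\<mu> \<bind> P) S) \<le> ennreal (1 / \<delta>) * ennreal \<eta>"
    by (rule mult_left_mono) simp
  then have "emeasure (\<mu> \<bind> P) S \<le> ennreal (\<eta> / \<delta>)"
    using \<delta> \<eta> by (simp add: mult.assoc[symmetric] ennreal_mult[symmetric])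
  then have "(emeasure P0 S)\<^sup>2 \<le> ennreal C * ennreal (\<eta> / \<delta>)"
    using dom[OF S] by (meson mult_left_mono order_trans zero_le)
  then have "(measure P0 S)\<^sup>2 \<le> C * (\<eta> / \<delta>)"
    using C \<eta> \<delta> by (simp add: P0.emeasure_eq_measure ennreal_power ennreal_mult[symmetric])
  then have PS: "emeasure P0 S \<le> ennreal (sqrt (C * (\<eta> / \<delta>)))"
    by (simp add: P0.emeasure_eq_measure real_le_rsqrt ennreal_leI)
  have "(\<integral>\<^sup>+x. emeasure (\<kappa> x) B \<partial>P0)
      \<le> (\<integral>\<^sup>+x. indicator A x + ennreal \<delta> + indicator S x \<partial>P0)"
  proof (intro nn_integral_mono)
    fix x assume "x \<in> space P0"
    then have x: "x \<in> space X" by (simp add: sp)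
    show "emeasure (\<kappa> x) B \<le> indicator A x + ennreal \<delta> + indicator S x"
    proof (cases "x \<in> A \<or> x \<in> S")
      case True
      then have "1 \<le> indicator A x + ennreal \<delta> + indicator S x"
        by (auto simp: indicator_def add_increasing2 add_increasing)
      then show ?thesis using k1[OF x] by (rule order_trans[rotated])
    next
      case False
      then show ?thesis using x by (auto simp: S_def not_less)
    qed
  qed
  also have "\<dots> = emeasure P0 A + ennreal \<delta> + emeasure P0 S"
    using A S sP0 by (simp add: nn_integral_add P0.emeasure_space_1)
  also have "\<dots> \<le> emeasure P0 A + ennreal \<delta> + ennreal (sqrt (C * (\<eta> / \<delta>)))"
    using PS by (intro add_left_mono)
  finally show ?thesis .
qed

section \<open>The sieve prior\<close>

lemma prior_scale_pos: "\<tau>0 > 0 \<Longrightarrow> j \<ge> 1 \<Longrightarrow> prior_scale \<tau>0 q j > 0"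
  by (simp add: prior_scale_def)

text \<open>Length of the interval times the density, where \<open>x\<^sup>2 \<le> 2 (a\<^sup>2 + \<rho>\<^sup>2)\<close> on the interval.\<close>
lemma emeasure_normal_interval_ge:
  assumes \<sigma>: "\<sigma> > 0" and \<rho>: "\<rho> \<ge> 0"
  shows "ennreal (2 * \<rho> / (sqrt (2 * pi) * \<sigma>) * exp (- ((a\<^sup>2 + \<rho>\<^sup>2) / \<sigma>\<^sup>2)))
    \<le> emeasure (density lborel (normal_density 0 \<sigma>)) {a - \<rho>..a + \<rho>}"
proof -
  let ?d = "1 / (sqrt (2 * pi) * \<sigma>) * exp (- ((a\<^sup>2 + \<rho>\<^sup>2) / \<sigma>\<^sup>2))"
  have dens: "?d \<le> normal_density 0 \<sigma> x" if "x \<in> {a - \<rho>..a + \<rho>}" for x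
  proof -
    have "\<bar>x - a\<bar> \<le> \<rho>" using that by auto
    then have "(x - a)\<^sup>2 \<le> \<rho>\<^sup>2" using \<rho> by (metis abs_of_nonneg abs_le_square_iff)
    moreover have "0 \<le> (x - 2 * a)\<^sup>2" by simp
    ultimately have "x\<^sup>2 \<le> 2 * (a\<^sup>2 + \<rho>\<^sup>2)"
      by (simp add: power2_eq_square algebra_simps)
    then have "x\<^sup>2 / (2 * \<sigma>\<^sup>2) \<le> (a\<^sup>2 + \<rho>\<^sup>2) / \<sigma>\<^sup>2"
      using \<sigma> by (simp add: field_simps)
    then show ?thesis
      using \<sigma> by (simp add: normal_density_def real_sqrt_mult divide_right_mono)
  qed
  have "ennreal (2 * \<rho> / (sqrt (2 * pi) * \<sigma>) * exp (- ((a\<^sup>2 + \<rho>\<^sup>2) / \<sigma>\<^sup>2))) = ennreal ?d * ennreal (2 * \<rho>)"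
    using \<sigma> \<rho> by (simp add: ennreal_mult[symmetric])
  also have "\<dots> = (\<integral>\<^sup>+x. ennreal ?d * indicator {a - \<rho>..a + \<rho>} x \<partial>lborel)"
    using \<rho> by (simp add: nn_integral_cmult_indicator)
  also have "\<dots> \<le> (\<integral>\<^sup>+x. ennreal (normal_density 0 \<sigma> x) * indicator {a - \<rho>..a + \<rho>} x \<partial>lborel)"
    using dens by (intro nn_integral_mono) (auto simp: indicator_def ennreal_leI)
  also have "\<dots> = emeasure (density lborel (normal_density 0 \<sigma>)) {a - \<rho>..a + \<rho>}"
    by (simp add: emeasure_density)
  finally show ?thesis .
qed

text \<open>
  The bound is made free of \<open>q\<close>: for \<open>0 \<le> q \<le> 1\<close> the prior variance lies between
  \<open>\<tau>0 j\<^bsup>-2\<^esup>\<close> and \<open>\<tau>0\<close>.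
\<close>
lemma emeasure_prior_coordinate_ge:
  assumes \<tau>0: "\<tau>0 > 0" and q: "q \<ge> 0" "q \<le> 1" and j: "j \<ge> 1" and \<rho>: "\<rho> \<ge> 0"
  shows "ennreal (2 * \<rho> / sqrt (2 * pi * \<tau>0) * exp (- ((a\<^sup>2 + \<rho>\<^sup>2) * (real j)\<^sup>2 / \<tau>0)))
    \<le> emeasure (density lborel (normal_density 0 (prior_scale \<tau>0 q j))) {a - \<rho>..a + \<rho>}"
proof -
  let ?\<sigma> = "prior_scale \<tau>0 q j"
  have \<sigma>: "?\<sigma> > 0" by (rule prior_scale_pos[OF \<tau>0 j])
  have sq: "?\<sigma>\<^sup>2 = \<tau>0 * real j powr (- 2 * q)"
    using \<tau>0 by (simp add: prior_scale_def)
  have "real j powr (- 2 * q) \<le> real j powr 0"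
    using q j by (intro powr_mono) auto
  then have "?\<sigma> \<le> sqrt \<tau>0"
    using \<tau>0 j by (simp add: prior_scale_def)
  then have 1: "sqrt (2 * pi) * ?\<sigma> \<le> sqrt (2 * pi * \<tau>0)"
    by (simp add: real_sqrt_mult)
  have "real j powr (- 2) \<le> real j powr (- 2 * q)"
    using q j by (intro powr_mono) auto
  moreover have "real j powr (- 2) = 1 / (real j)\<^sup>2"
    using j by (simp add: powr_minus_divide)
  ultimately have "\<tau>0 * (1 / (real j)\<^sup>2) \<le> ?\<sigma>\<^sup>2"
    unfolding sq using \<tau>0 by (intro mult_left_mono) auto
  then have "(a\<^sup>2 + \<rho>\<^sup>2) / ?\<sigma>\<^sup>2 \<le> (a\<^sup>2 + \<rho>\<^sup>2) / (\<tau>0 * (1 / (real j)\<^sup>2))"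
    using \<tau>0 j \<sigma> by (intro divide_left_mono mult_pos_pos) auto
  then have 2: "(a\<^sup>2 + \<rho>\<^sup>2) / ?\<sigma>\<^sup>2 \<le> (a\<^sup>2 + \<rho>\<^sup>2) * (real j)\<^sup>2 / \<tau>0"
    by simp
  have "2 * \<rho> / sqrt (2 * pi * \<tau>0) * exp (- ((a\<^sup>2 + \<rho>\<^sup>2) * (real j)\<^sup>2 / \<tau>0))
      \<le> 2 * \<rho> / (sqrt (2 * pi) * ?\<sigma>) * exp (- ((a\<^sup>2 + \<rho>\<^sup>2) / ?\<sigma>\<^sup>2))"
    using 1 2 \<sigma> \<rho> \<tau>0 by (intro mult_mono divide_left_mono mult_pos_pos) auto
  then show ?thesis
    by (rule order_trans[OF ennreal_leI emeasure_normal_interval_ge[OF \<sigma> \<rho>]])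
qed

abbreviation sieve_coordinate :: "real \<Rightarrow> real \<Rightarrow> nat \<Rightarrow> nat \<Rightarrow> real measure" where
  "sieve_coordinate \<tau>0 q k j \<equiv>
     (if j \<le> k then density lborel (normal_density 0 (prior_scale \<tau>0 q j)) else return borel 0)"

lemma emeasure_sieve_box_ge:
  assumes \<tau>0: "\<tau>0 > 0" and q: "q \<ge> 0" "q \<le> 1" and \<rho>: "\<rho> \<ge> 0"
  shows "ennreal ((2 * \<rho> / sqrt (2 * pi * \<tau>0)) ^ k
           * exp (- ((\<Sum>j=1..k. (a j)\<^sup>2 * (real j)\<^sup>2) + (\<Sum>j=1..k. \<rho>\<^sup>2 * (real j)\<^sup>2)) / \<tau>0))
    \<le> emeasure (sieve_prior_given \<tau>0 q k) {\<theta>\<in>space seq_borel. \<forall>j\<in>{1..k}. \<theta> j \<in> {a j - \<rho>..a j + \<rho>}}"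
proof -
  have P: "prob_space (sieve_coordinate \<tau>0 q k j)" if "j \<in> {1..}" for j
    using that \<tau>0 by (auto intro!: prob_space_normal_density prob_space_return prior_scale_pos)
  let ?N = "sieve_coordinate \<tau>0 q k"
  have box: "{\<theta>\<in>space seq_borel. \<forall>j\<in>{1..k}. \<theta> j \<in> {a j - \<rho>..a j + \<rho>}}
      = prod_emb {1..} ?N {1..k} (\<Pi>\<^sub>E j\<in>{1..k}. {a j - \<rho>..a j + \<rho>})"
  proof -
    have "space (?N j) = UNIV" for j by simp
    then show ?thesis by (simp only: prod_emb_def space_PiM) (auto simp: restrict_PiE_iff Pi_iff)
  qed
  define f where "f = (\<lambda>j. 2 * \<rho> / sqrt (2 * pi * \<tau>0) * exp (- (((a j)\<^sup>2 + \<rho>\<^sup>2) * (real j)\<^sup>2 / \<tau>0)))"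
  have "(2 * \<rho> / sqrt (2 * pi * \<tau>0)) ^ k
      * exp (- ((\<Sum>j=1..k. (a j)\<^sup>2 * (real j)\<^sup>2) + (\<Sum>j=1..k. \<rho>\<^sup>2 * (real j)\<^sup>2)) / \<tau>0) = prod f {1..k}"
  proof -
    have "- ((\<Sum>j=1..k. (a j)\<^sup>2 * (real j)\<^sup>2) + (\<Sum>j=1..k. \<rho>\<^sup>2 * (real j)\<^sup>2)) / \<tau>0
       = (\<Sum>j=1..k. - (((a j)\<^sup>2 + \<rho>\<^sup>2) * (real j)\<^sup>2 / \<tau>0))"
      by (simp add: sum_negf sum_divide_distrib[symmetric] sum.distrib[symmetric] distrib_right)
    moreover have "prod f {1..k} = (2 * \<rho> / sqrt (2 * pi * \<tau>0)) ^ k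
        * exp (\<Sum>j=1..k. - (((a j)\<^sup>2 + \<rho>\<^sup>2) * (real j)\<^sup>2 / \<tau>0))"
      unfolding f_def prod.distrib by (simp add: exp_sum)
    ultimately show ?thesis by simp
  qed
  then have "ennreal ((2 * \<rho> / sqrt (2 * pi * \<tau>0)) ^ k
      * exp (- ((\<Sum>j=1..k. (a j)\<^sup>2 * (real j)\<^sup>2) + (\<Sum>j=1..k. \<rho>\<^sup>2 * (real j)\<^sup>2)) / \<tau>0))
      = (\<Prod>j=1..k. ennreal (f j))"
    using \<tau>0 \<rho> by (simp add: prod_ennreal f_def)
  also have "\<dots> \<le> (\<Prod>j=1..k. emeasure (?N j) {a j - \<rho>..a j + \<rho>})"
  proof (rule prod_mono_ennreal)
    fix j assume "j \<in> {1..k}"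
    then show "ennreal (f j) \<le> emeasure (?N j) {a j - \<rho>..a j + \<rho>}"
      using emeasure_prior_coordinate_ge[OF \<tau>0 q _ \<rho>, of j "a j"] by (simp add: f_def)
  qed
  also have "\<dots> = emeasure (sieve_prior_given \<tau>0 q k)
      (prod_emb {1..} ?N {1..k} (\<Pi>\<^sub>E j\<in>{1..k}. {a j - \<rho>..a j + \<rho>}))"
    unfolding sieve_prior_given_def
    by (rule emeasure_PiM_emb[symmetric]) (use P in auto)
  finally show ?thesis unfolding box .
qed

lemma AE_sieve_prior_given_support:
  assumes \<tau>0: "\<tau>0 > 0"
  shows "AE \<theta> in sieve_prior_given \<tau>0 q k. \<forall>j>k. \<theta> j = 0"
proof -
  have P: "prob_space (sieve_coordinate \<tau>0 q k j)" if "j \<in> {1..}" for j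
    using that \<tau>0 by (auto intro!: prob_space_normal_density prob_space_return prior_scale_pos)
  have "AE \<theta> in sieve_prior_given \<tau>0 q k. j > k \<longrightarrow> \<theta> j = 0" for j
  proof (cases "j > k")
    case True
    show ?thesis
      unfolding sieve_prior_given_def
      by (rule AE_PiM_component[OF P]) (use True in \<open>auto simp: AE_return\<close>)
  qed simp
  then show ?thesis by (simp add: AE_all_countable)
qed

lemma nn_integral_sieve_prior:
  assumes \<tau>0: "\<tau>0 > 0" and f: "f \<in> borel_measurable seq_borel"
  shows "(\<integral>\<^sup>+\<theta>. f \<theta> \<partial>sieve_prior rate \<tau>0 q)
     = (\<integral>\<^sup>+k. (\<integral>\<^sup>+\<theta>. f \<theta> \<partial>sieve_prior_given \<tau>0 q k) \<partial>measure_pmf (poisson_pmf rate))"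
proof -
  have "sieve_prior_given \<tau>0 q \<in> measure_pmf (poisson_pmf rate) \<rightarrow>\<^sub>M prob_algebra seq_borel"
    using sieve_prior_given_prob[OF \<tau>0] by simp
  then show ?thesis
    unfolding sieve_prior_def
    by (intro nn_integral_bind[OF f] measurable_prob_algebraD)
qed

lemma sets_sieve_prior:
  assumes "\<tau>0 > 0"
  shows "sets (sieve_prior rate \<tau>0 q) = sets seq_borel" "space (sieve_prior rate \<tau>0 q) = space seq_borel"
  using sieve_prior_prob[OF assms, of rate q] by (auto simp: space_prob_algebra dest: sets_eq_imp_space_eq)

lemma sets_sieve_prior_given:
  assumes "\<tau>0 > 0"
  shows "sets (sieve_prior_given \<tau>0 q k) = sets seq_borel"
    "space (sieve_prior_given \<tau>0 q k) = space seq_borel"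
    "prob_space (sieve_prior_given \<tau>0 q k)"
  using sieve_prior_given_prob[OF assms, of q k] by (auto simp: space_prob_algebra dest: sets_eq_imp_space_eq)

lemma white_noise_kernel_sieve_prior:
  "\<tau>0 > 0 \<Longrightarrow> white_noise n \<in> sieve_prior rate \<tau>0 q \<rightarrow>\<^sub>M subprob_algebra seq_borel"
  using measurable_prob_algebraD[OF white_noise_kernel]
  by (simp cong: measurable_cong_sets add: sets_sieve_prior)

lemma emeasure_marginal:
  assumes \<tau>0: "\<tau>0 > 0" and S: "S \<in> sets seq_borel"
  shows "emeasure (sieve_prior rate \<tau>0 q \<bind> white_noise n) S
     = (\<integral>\<^sup>+k. (\<integral>\<^sup>+\<theta>. emeasure (white_noise n \<theta>) S \<partial>sieve_prior_given \<tau>0 q k) \<partial>measure_pmf (poisson_pmf rate))"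
proof -
  have "space (sieve_prior rate \<tau>0 q) \<noteq> {}"
    by (simp add: sets_sieve_prior[OF \<tau>0] space_PiM PiE_eq_empty_iff)
  then have "emeasure (sieve_prior rate \<tau>0 q \<bind> white_noise n) S
      = (\<integral>\<^sup>+\<theta>. emeasure (white_noise n \<theta>) S \<partial>sieve_prior rate \<tau>0 q)"
    by (intro emeasure_bind[OF _ white_noise_kernel_sieve_prior[OF \<tau>0] S])
  then show ?thesis
    by (simp add: nn_integral_sieve_prior[OF \<tau>0 measurable_white_noise_emeasure[OF S]])
qed

section \<open>Sobolev sequences and the prior mass around them\<close>

lemma l2_norm_sq_le:
  assumes "\<And>m. (\<Sum>j=1..m. (a j)\<^sup>2) \<le> D"
  shows "l2_norm_sq a \<le> ennreal D"
  unfolding l2_norm_sq_def suminf_eq_SUP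
proof (rule SUP_least)
  fix m
  have "(\<Sum>i<m. ennreal ((a (Suc i))\<^sup>2)) = ennreal (\<Sum>j=1..m. (a j)\<^sup>2)"
    by (simp add: sum.atLeast1_atMost_eq sum_ennreal)
  also have "\<dots> \<le> ennreal D" by (intro ennreal_leI assms)
  finally show "(\<Sum>i<m. ennreal ((a (Suc i))\<^sup>2)) \<le> ennreal D" .
qed

lemma sobolev_partial_sum_le:
  assumes "\<theta> \<in> sobolev_class \<beta> L0" and "L0 > 0"
  shows "(\<Sum>j=1..m. (\<theta> j)\<^sup>2 * real j powr (2 * \<beta>)) \<le> L0"
proof -
  have "ennreal (\<Sum>j=1..m. (\<theta> j)\<^sup>2 * real j powr (2 * \<beta>))
      = (\<Sum>i<m. ennreal ((\<theta> (Suc i))\<^sup>2 * real (Suc i) powr (2 * \<beta>)))"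
    by (simp add: sum.atLeast1_atMost_eq sum_ennreal)
  also have "\<dots> \<le> (\<Sum>i. ennreal ((\<theta> (Suc i))\<^sup>2 * real (Suc i) powr (2 * \<beta>)))"
    by (rule sum_le_suminf) auto
  also have "\<dots> < ennreal L0" using assms by (simp add: sobolev_class_def)
  finally show ?thesis using assms(2) by (simp add: ennreal_less_iff sum_nonneg)
qed

lemma sobolev_tail_le:
  assumes \<theta>: "\<theta> \<in> sobolev_class \<beta> L0" "L0 > 0" and \<beta>: "\<beta> \<ge> 0" and k: "k \<ge> 1"
  shows "(\<Sum>j\<in>{k<..m}. (\<theta> j)\<^sup>2) \<le> L0 * real k powr (- 2 * \<beta>)"
proof -
  have "(\<Sum>j\<in>{k<..m}. (\<theta> j)\<^sup>2) * real k powr (2 * \<beta>) = (\<Sum>j\<in>{k<..m}. (\<theta> j)\<^sup>2 * real k powr (2 * \<beta>))"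
    by (rule sum_distrib_right)
  also have "\<dots> \<le> (\<Sum>j\<in>{k<..m}. (\<theta> j)\<^sup>2 * real j powr (2 * \<beta>))"
    using \<beta> by (intro sum_mono mult_left_mono powr_mono2) auto
  also have "\<dots> \<le> (\<Sum>j=1..m. (\<theta> j)\<^sup>2 * real j powr (2 * \<beta>))"
    by (intro sum_mono2) auto
  also have "\<dots> \<le> L0" by (rule sobolev_partial_sum_le[OF \<theta>])
  finally show ?thesis using k by (simp add: powr_minus field_simps)
qed

text \<open>
  With this constant \<open>y\<close>, the prior mass of a box of radius \<open>1/n\<close> in the first \<open>k\<close> coordinates is at
  least \<open>(y / n\<^sup>2)\<^sup>k\<close>; the factors come from the Poisson weight, the normalization of the Gaussian
  densities, and their exponents.
\<close>
definition prior_mass_constant :: "real \<Rightarrow> real \<Rightarrow> real \<Rightarrow> real" where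
  "prior_mass_constant rate \<tau>0 L0 = rate * exp (- rate) * (2 / sqrt (2 * pi * \<tau>0)) * exp (- (L0 + 1) / \<tau>0)"

text \<open>
  Each coordinate costs one factor \<open>1/n\<close> for the length of the interval and one for \<open>k! \<le> n\<^sup>k\<close> in the
  Poisson weight; a third one absorbs the constant. The smoothness of \<open>\<theta>\<^sub>0\<close> keeps the Gaussian
  exponent linear in \<open>k\<close>.
\<close>
lemma sieve_prior_mass_ge:
  assumes rate: "rate > 0" and \<tau>0: "\<tau>0 > 0" and q: "q \<ge> 0" "q \<le> 1"
    and L0: "L0 > 0" and \<beta>: "\<beta> \<ge> 1/2" and \<theta>0: "\<theta>0 \<in> sobolev_class \<beta> L0"
    and k: "1 \<le> k" "k \<le> n" and n: "1 / real n \<le> prior_mass_constant rate \<tau>0 L0"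
  shows "ennreal (exp (- (3 * (real k * ln (real n)))))
    \<le> ennreal (pmf (poisson_pmf rate) k)
      * emeasure (sieve_prior_given \<tau>0 q k)
          {\<theta>\<in>space seq_borel. \<forall>j\<in>{1..k}. \<theta> j \<in> {\<theta>0 j - 1 / real n..\<theta>0 j + 1 / real n}}"
proof -
  let ?y = "prior_mass_constant rate \<tau>0 L0"
  let ?a = "\<Sum>j=1..k. (\<theta>0 j)\<^sup>2 * (real j)\<^sup>2"
  let ?b = "\<Sum>j=1..k. (1 / real n)\<^sup>2 * (real j)\<^sup>2"
  have np: "real n > 0" using k by simp
  have a: "?a \<le> real k * L0"
  proof -
    (* j^2 <= k j <= k j^(2 \<beta>), because 2 \<beta> >= 1 *)
    have "?a \<le> (\<Sum>j=1..k. real k * ((\<theta>0 j)\<^sup>2 * real j powr (2 * \<beta>)))"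
    proof (rule sum_mono)
      fix j assume j: "j \<in> {1..k}"
      then have "real j powr 1 \<le> real j powr (2 * \<beta>)" using \<beta> by (intro powr_mono) auto
      then have "real j * real j \<le> real k * real j powr (2 * \<beta>)" using j by (intro mult_mono) auto
      then have "(\<theta>0 j)\<^sup>2 * (real j * real j) \<le> (\<theta>0 j)\<^sup>2 * (real k * real j powr (2 * \<beta>))"
        by (rule mult_left_mono) simp
      then show "(\<theta>0 j)\<^sup>2 * (real j)\<^sup>2 \<le> real k * ((\<theta>0 j)\<^sup>2 * real j powr (2 * \<beta>))"
        by (simp add: power2_eq_square ac_simps)
    qed
    also have "\<dots> \<le> real k * L0"
      unfolding sum_distrib_left[symmetric]
      by (intro mult_left_mono sobolev_partial_sum_le[OF \<theta>0 L0]) simp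
    finally show ?thesis .
  qed
  have b: "?b \<le> real k"
  proof -
    have "?b \<le> (\<Sum>j=1..k. 1)"
    proof (rule sum_mono)
      fix j assume "j \<in> {1..k}"
      then have "real j / real n \<le> 1" using k np by simp
      then have "(real j / real n)\<^sup>2 \<le> 1" by (simp add: power_le_one)
      then show "(1 / real n)\<^sup>2 * (real j)\<^sup>2 \<le> 1" by (simp add: power_divide)
    qed
    then show ?thesis by simp
  qed
  have e1: "exp (- (?a + ?b) / \<tau>0) \<ge> exp (- (L0 + 1) / \<tau>0) ^ k"
  proof -
    have "?a + ?b \<le> real k * (L0 + 1)" using a b by (simp add: algebra_simps)
    then have "- (real k * (L0 + 1)) / \<tau>0 \<le> - (?a + ?b) / \<tau>0"
      using \<tau>0 by (intro divide_right_mono) auto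
    then show ?thesis by (simp add: exp_of_nat_mult[symmetric] algebra_simps)
  qed
  have e2: "pmf (poisson_pmf rate) k \<ge> (rate * exp (- rate) / real n) ^ k"
  proof -
    have "fact k \<le> real k ^ k" using fact_le_power[of k, where 'a=real] by simp
    also have "\<dots> \<le> real n ^ k" using k by (intro power_mono) auto
    finally have "fact k \<le> real n ^ k" .
    then have 1: "rate ^ k / real n ^ k \<le> rate ^ k / fact k"
      using rate np by (intro divide_left_mono) auto
    have "exp (- rate) ^ k \<le> exp (- rate) ^ 1"
      using rate k by (intro power_decreasing) auto
    with 1 have "rate ^ k / real n ^ k * exp (- rate) ^ k \<le> rate ^ k / fact k * exp (- rate)"
      using rate by (intro mult_mono) auto
    then show ?thesis using rate by (simp add: power_mult_distrib power_divide)
  qed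
  have "exp (- (3 * (real k * ln (real n)))) = (1 / real n * (1 / (real n)\<^sup>2)) ^ k"
  proof -
    have "1 / real n * (1 / (real n)\<^sup>2) = exp (- (3 * ln (real n)))"
    proof -
      have "exp (3 * ln (real n)) = real n ^ 3"
        using np exp_of_nat_mult[of 3 "ln (real n)"] by simp
      then show ?thesis by (simp add: exp_minus power2_eq_square power3_eq_cube inverse_eq_divide)
    qed
    then show ?thesis by (simp add: exp_of_nat_mult[symmetric] algebra_simps)
  qed
  also have "\<dots> \<le> (?y * (1 / (real n)\<^sup>2)) ^ k"
    using n np by (intro power_mono mult_right_mono) auto
  also have "\<dots> = (rate * exp (- rate) / real n) ^ k
      * ((2 * (1 / real n) / sqrt (2 * pi * \<tau>0)) ^ k * exp (- (L0 + 1) / \<tau>0) ^ k)"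
    unfolding power_mult_distrib[symmetric] prior_mass_constant_def
    by (simp add: power2_eq_square ac_simps)
  also have "\<dots> \<le> pmf (poisson_pmf rate) k * ((2 * (1 / real n) / sqrt (2 * pi * \<tau>0)) ^ k * exp (- (?a + ?b) / \<tau>0))"
    using e1 e2 rate \<tau>0 by (intro mult_mono mult_left_mono) auto
  finally have main: "exp (- (3 * (real k * ln (real n)))) \<le> pmf (poisson_pmf rate) k
      * ((2 * (1 / real n) / sqrt (2 * pi * \<tau>0)) ^ k * exp (- (?a + ?b) / \<tau>0))" .
  have "ennreal (exp (- (3 * (real k * ln (real n))))) \<le> ennreal (pmf (poisson_pmf rate) k)
      * ennreal ((2 * (1 / real n) / sqrt (2 * pi * \<tau>0)) ^ k * exp (- (?a + ?b) / \<tau>0))"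
    using main \<tau>0 by (subst ennreal_mult[symmetric]) (auto intro!: ennreal_leI)
  also have "\<dots> \<le> ennreal (pmf (poisson_pmf rate) k)
      * emeasure (sieve_prior_given \<tau>0 q k)
          {\<theta>\<in>space seq_borel. \<forall>j\<in>{1..k}. \<theta> j \<in> {\<theta>0 j - 1 / real n..\<theta>0 j + 1 / real n}}"
    by (intro mult_left_mono emeasure_sieve_box_ge[OF \<tau>0 q]) auto
  finally show ?thesis .
qed

section \<open>Comparison of the true law with the marginal law\<close>

text \<open>
  The marginal law is at least the part of the mixture that comes from sieve dimension \<open>k\<close> and from
  the box around \<open>\<theta>\<^sub>0\<close>. On this part the squared distance to \<open>\<theta>\<^sub>0\<close> consists of at most
  \<open>k / n\<^sup>2\<close> from the box and of the bias of \<open>\<theta>\<^sub>0\<close> beyond \<open>k\<close>, so the likelihood factor is at most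
  \<open>exp ((1 + L0) R)\<close> with \<open>R = k ln n\<close>; the prior mass contributes \<open>exp (3 R)\<close>.
\<close>
lemma marginal_dominates_truth:
  assumes rate: "rate > 0" and \<tau>0: "\<tau>0 > 0" and q: "q \<ge> 0" "q \<le> 1"
    and L0: "L0 > 0" and \<beta>: "\<beta> \<ge> 1/2" and \<theta>0: "\<theta>0 \<in> sobolev_class \<beta> L0"
    and k: "1 \<le> k" "k \<le> n" and n: "1 / real n \<le> prior_mass_constant rate \<tau>0 L0" "1 \<le> ln (real n)"
    and bias: "real n * real k powr (- 2 * \<beta>) \<le> real k * ln (real n)"
    and S: "S \<in> sets seq_borel"
  shows "(emeasure (white_noise n \<theta>0) S)\<^sup>2
    \<le> ennreal (exp ((L0 + 4) * (real k * ln (real n))))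
      * emeasure (sieve_prior rate \<tau>0 q \<bind> white_noise n) S"
proof -
  define R where "R = real k * ln (real n)"
  define D where "D = real k / (real n)\<^sup>2 + L0 * real k powr (- 2 * \<beta>)"
  define p where "p = emeasure (white_noise n \<theta>0) S"
  define box where "box = {\<theta>\<in>space seq_borel. \<forall>j\<in>{1..k}. \<theta> j \<in> {\<theta>0 j - 1 / real n..\<theta>0 j + 1 / real n}}"
  let ?\<Pi> = "sieve_prior_given \<tau>0 q"
  have np: "real n > 0" using k by simp
  have R1: "R \<ge> 1" unfolding R_def using k n mult_mono[of 1 "real k" 1 "ln (real n)"] by simp
  have nD: "real n * D \<le> (1 + L0) * R"
  proof -
    have "real n * D = real k / real n + L0 * (real n * real k powr (- 2 * \<beta>))"
      unfolding D_def using np by (simp add: power2_eq_square field_simps)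
    also have "\<dots> \<le> 1 + L0 * R"
      using k np L0 bias unfolding R_def by (intro add_mono mult_left_mono) auto
    also have "\<dots> \<le> (1 + L0) * R" using R1 by (simp add: algebra_simps)
    finally show ?thesis .
  qed
  have near: "(\<Sum>j=1..m. (\<theta>0 j - \<theta> j)\<^sup>2) \<le> D" if "\<theta> \<in> box" "\<forall>j>k. \<theta> j = 0" for \<theta> m
  proof -
    have "(\<Sum>j=1..m. (\<theta>0 j - \<theta> j)\<^sup>2) \<le> (\<Sum>j\<in>{1..k} \<union> {k<..m}. (\<theta>0 j - \<theta> j)\<^sup>2)"
      by (intro sum_mono2) auto
    also have "\<dots> = (\<Sum>j=1..k. (\<theta>0 j - \<theta> j)\<^sup>2) + (\<Sum>j\<in>{k<..m}. (\<theta>0 j - \<theta> j)\<^sup>2)"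
      by (intro sum.union_disjoint) auto
    also have "(\<Sum>j=1..k. (\<theta>0 j - \<theta> j)\<^sup>2) \<le> (\<Sum>j=1..k. (1 / real n)\<^sup>2)"
    proof (intro sum_mono)
      fix j assume "j \<in> {1..k}"
      then have "\<theta> j \<in> {\<theta>0 j - 1 / real n..\<theta>0 j + 1 / real n}"
        using that(1) unfolding box_def by blast
      then have "\<bar>\<theta>0 j - \<theta> j\<bar> \<le> 1 / real n" by (simp add: abs_le_iff)
      then show "(\<theta>0 j - \<theta> j)\<^sup>2 \<le> (1 / real n)\<^sup>2"
        using np by (subst power2_le_iff_abs_le) auto
    qed
    also have "(\<Sum>j=1..k. (1 / real n)\<^sup>2) = real k / (real n)\<^sup>2" by (simp add: power_divide)
    also have "(\<Sum>j\<in>{k<..m}. (\<theta>0 j - \<theta> j)\<^sup>2) = (\<Sum>j\<in>{k<..m}. (\<theta>0 j)\<^sup>2)"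
      using that(2) by (intro sum.cong) auto
    also have "\<dots> \<le> L0 * real k powr (- 2 * \<beta>)"
      using \<beta> k by (intro sobolev_tail_le[OF \<theta>0 L0]) auto
    finally show ?thesis by (simp add: D_def)
  qed
  have box: "box \<in> sets (?\<Pi> k)"
    unfolding box_def sets_sieve_prior_given[OF \<tau>0] by measurable
  have pm: "(\<lambda>\<theta>. emeasure (white_noise n \<theta>) S) \<in> borel_measurable (?\<Pi> k)"
    using measurable_white_noise_emeasure[OF S]
    by (simp cong: measurable_cong_sets add: sets_sieve_prior_given[OF \<tau>0])
  have "p\<^sup>2 * emeasure (?\<Pi> k) box = (\<integral>\<^sup>+\<theta>. p\<^sup>2 * indicator box \<theta> \<partial>?\<Pi> k)"
    using box by (simp add: nn_integral_cmult_indicator)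
  also have "\<dots> \<le> (\<integral>\<^sup>+\<theta>. ennreal (exp (real n * D)) * emeasure (white_noise n \<theta>) S \<partial>?\<Pi> k)"
  proof (intro nn_integral_mono_AE)
    show "AE \<theta> in ?\<Pi> k. p\<^sup>2 * indicator box \<theta> \<le> ennreal (exp (real n * D)) * emeasure (white_noise n \<theta>) S"
      using AE_sieve_prior_given_support[OF \<tau>0, of k q]
    proof eventually_elim
      case (elim \<theta>)
      then show ?case
        using white_noise_sq_le[OF _ S near, of n \<theta>] k
        by (cases "\<theta> \<in> box") (auto simp: p_def)
    qed
  qed
  also have "\<dots> = ennreal (exp (real n * D)) * (\<integral>\<^sup>+\<theta>. emeasure (white_noise n \<theta>) S \<partial>?\<Pi> k)"
    by (rule nn_integral_cmult[OF pm])
  finally have given: "p\<^sup>2 * emeasure (?\<Pi> k) box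
      \<le> ennreal (exp (real n * D)) * (\<integral>\<^sup>+\<theta>. emeasure (white_noise n \<theta>) S \<partial>?\<Pi> k)" .
  define g where "g = (\<lambda>k. \<integral>\<^sup>+\<theta>. emeasure (white_noise n \<theta>) S \<partial>?\<Pi> k)"
  have "ennreal (pmf (poisson_pmf rate) k) * g k
      = (\<integral>\<^sup>+i. g k * indicator {k} i \<partial>measure_pmf (poisson_pmf rate))"
    by (simp add: nn_integral_cmult_indicator emeasure_pmf_single mult.commute)
  also have "\<dots> \<le> (\<integral>\<^sup>+i. g i \<partial>measure_pmf (poisson_pmf rate))"
    by (intro nn_integral_mono) (auto simp: indicator_def)
  finally have mix: "ennreal (pmf (poisson_pmf rate) k) * g k
      \<le> emeasure (sieve_prior rate \<tau>0 q \<bind> white_noise n) S"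
    by (simp add: emeasure_marginal[OF \<tau>0 S] g_def)
  have "ennreal (exp (- (3 * R))) * p\<^sup>2
      \<le> (ennreal (pmf (poisson_pmf rate) k) * emeasure (?\<Pi> k) box) * p\<^sup>2"
    unfolding R_def box_def
    by (intro mult_right_mono sieve_prior_mass_ge[OF rate \<tau>0 q L0 \<beta> \<theta>0 k n(1)]) auto
  also have "\<dots> = ennreal (pmf (poisson_pmf rate) k) * (p\<^sup>2 * emeasure (?\<Pi> k) box)"
    by (simp add: ac_simps)
  also have "\<dots> \<le> ennreal (pmf (poisson_pmf rate) k) * (ennreal (exp (real n * D)) * g k)"
    using given by (intro mult_left_mono) (auto simp: g_def)
  also have "\<dots> = ennreal (exp (real n * D)) * (ennreal (pmf (poisson_pmf rate) k) * g k)"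
    by (simp add: ac_simps)
  also have "\<dots> \<le> ennreal (exp ((1 + L0) * R)) * emeasure (sieve_prior rate \<tau>0 q \<bind> white_noise n) S"
    using nD mix by (intro mult_mono ennreal_leI) auto
  finally have "ennreal (exp (3 * R)) * (ennreal (exp (- (3 * R))) * p\<^sup>2)
     \<le> ennreal (exp (3 * R)) * (ennreal (exp ((1 + L0) * R)) * emeasure (sieve_prior rate \<tau>0 q \<bind> white_noise n) S)"
    by (rule mult_left_mono) simp
  moreover have "ennreal (exp (3 * R)) * (ennreal (exp (- (3 * R))) * p\<^sup>2) = p\<^sup>2"
    by (simp add: mult.assoc[symmetric] ennreal_mult[symmetric] exp_minus)
  moreover have "exp (3 * R) * exp ((1 + L0) * R) = exp ((L0 + 4) * R)"
    unfolding exp_add[symmetric] by (rule arg_cong[where f=exp]) (simp add: algebra_simps)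
  then have "ennreal (exp (3 * R)) * ennreal (exp ((1 + L0) * R)) = ennreal (exp ((L0 + 4) * R))"
    by (metis ennreal_mult exp_ge_zero)
  ultimately show ?thesis
    by (simp only: mult.assoc[symmetric] p_def R_def)
qed

section \<open>Errors of the second kind, averaged over the prior\<close>

text \<open>Markov's inequality for \<open>z\<^sup>Y\<close>, whose mean is \<open>exp (rate (z - 1))\<close> for a Poisson variable \<open>Y\<close>.\<close>
lemma poisson_chernoff:
  assumes rate: "rate > 0" and z: "z \<ge> 1"
  shows "measure_pmf.prob (poisson_pmf rate) {m..} \<le> exp (rate * z) / z ^ m"
proof -
  have sums: "(\<lambda>k. rate ^ k / fact k * exp (- rate) * z ^ k) sums (exp (- rate) * exp (rate * z))"
    using sums_mult[OF exp_converges[of "rate * z"], of "exp (- rate)"]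
    by (simp add: power_mult_distrib field_simps scaleR_conv_of_real)
  have "ennreal (z ^ m) * emeasure (measure_pmf (poisson_pmf rate)) {m..}
      = (\<integral>\<^sup>+k. ennreal (z ^ m) * indicator {m..} k \<partial>measure_pmf (poisson_pmf rate))"
    by (simp add: nn_integral_cmult_indicator)
  also have "\<dots> \<le> (\<integral>\<^sup>+k. ennreal (z ^ k) \<partial>measure_pmf (poisson_pmf rate))"
    using z by (intro nn_integral_mono) (auto simp: indicator_def intro!: ennreal_leI power_increasing)
  also have "\<dots> = (\<Sum>k. ennreal (rate ^ k / fact k * exp (- rate) * z ^ k))"
    using rate z by (simp add: nn_integral_measure_pmf nn_integral_count_space_nat ennreal_mult[symmetric])
  also have "\<dots> = ennreal (exp (- rate) * exp (rate * z))"
    using rate z by (intro suminf_ennreal_eq sums) auto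
  also have "\<dots> \<le> ennreal (exp (rate * z))"
    using rate by (intro ennreal_leI) (simp add: mult_le_cancel_right1)
  finally have "z ^ m * measure_pmf.prob (poisson_pmf rate) {m..} \<le> exp (rate * z)"
    using z by (simp add: measure_pmf.emeasure_eq_measure ennreal_mult[symmetric])
  then show ?thesis using z by (simp add: field_simps)
qed

lemma norm_split_at_sieve:
  assumes b: "b > 0"
    and far: "ennreal b \<le> l2_norm_sq (\<lambda>j. \<theta> j - \<theta>0 j)"
    and supp: "\<forall>j>N. \<theta> j = 0" and tail: "\<And>m. (\<Sum>j\<in>{N<..m}. (\<theta>0 j)\<^sup>2) \<le> b / 2"
  shows "b / 2 \<le> (\<Sum>j=1..N. (\<theta> j - \<theta>0 j)\<^sup>2)"
proof -
  have "l2_norm_sq (\<lambda>j. \<theta> j - \<theta>0 j) \<le> ennreal ((\<Sum>j=1..N. (\<theta> j - \<theta>0 j)\<^sup>2) + b / 2)"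
  proof (rule l2_norm_sq_le)
    fix m
    have "(\<Sum>j=1..m. (\<theta> j - \<theta>0 j)\<^sup>2) \<le> (\<Sum>j\<in>{1..N} \<union> {N<..m}. (\<theta> j - \<theta>0 j)\<^sup>2)"
      by (intro sum_mono2) auto
    also have "\<dots> = (\<Sum>j=1..N. (\<theta> j - \<theta>0 j)\<^sup>2) + (\<Sum>j\<in>{N<..m}. (\<theta> j - \<theta>0 j)\<^sup>2)"
      by (intro sum.union_disjoint) auto
    also have "(\<Sum>j\<in>{N<..m}. (\<theta> j - \<theta>0 j)\<^sup>2) = (\<Sum>j\<in>{N<..m}. (\<theta>0 j)\<^sup>2)"
      using supp by (intro sum.cong) auto
    finally show "(\<Sum>j=1..m. (\<theta> j - \<theta>0 j)\<^sup>2) \<le> (\<Sum>j=1..N. (\<theta> j - \<theta>0 j)\<^sup>2) + b / 2"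
      using tail[of m] by simp
  qed
  with far have "ennreal b \<le> ennreal ((\<Sum>j=1..N. (\<theta> j - \<theta>0 j)\<^sup>2) + b / 2)" by (rule order_trans)
  then have "b \<le> (\<Sum>j=1..N. (\<theta> j - \<theta>0 j)\<^sup>2) + b / 2"
    using b by (subst (asm) ennreal_le_iff) (auto intro!: add_nonneg_nonneg sum_nonneg)
  then show ?thesis by simp
qed

text \<open>
  At least half of the squared distance \<open>b\<close> sits in the first \<open>N\<close> coordinates. If the data are within
  squared distance \<open>b / 8\<close> of \<open>\<theta>\<^sub>0\<close> there, then
  \<open>\<parallel>\<theta> - \<theta>\<^sub>0\<parallel>\<^sup>2 \<le> 2 \<parallel>x - \<theta>\<parallel>\<^sup>2 + 2 \<parallel>x - \<theta>\<^sub>0\<parallel>\<^sup>2\<close> puts them at squared distance at least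
  \<open>b / 4 - b / 8\<close> from \<open>\<theta>\<close>.
\<close>
lemma test_type_two_error:
  assumes n: "n \<ge> 1" and b: "b > 0" and \<theta>: "\<theta> \<in> space seq_borel"
    and far: "ennreal b \<le> l2_norm_sq (\<lambda>j. \<theta> j - \<theta>0 j)"
    and supp: "\<forall>j>N. \<theta> j = 0" and tail: "\<And>m. (\<Sum>j\<in>{N<..m}. (\<theta>0 j)\<^sup>2) \<le> b / 2"
  shows "emeasure (white_noise n \<theta>) (space seq_borel - {x\<in>space seq_borel. b / 8 \<le> (\<Sum>j=1..N. (x j - \<theta>0 j)\<^sup>2)})
     \<le> ennreal (2 ^ N * exp (- (real n * b) / 32))"
proof -
  have "space seq_borel - {x\<in>space seq_borel. b / 8 \<le> (\<Sum>j=1..N. (x j - \<theta>0 j)\<^sup>2)}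
      \<subseteq> {x\<in>space seq_borel. b / 8 \<le> (\<Sum>j=1..N. (x j - \<theta> j)\<^sup>2)}"
  proof (rule subsetI)
    fix x assume x: "x \<in> space seq_borel - {x\<in>space seq_borel. b / 8 \<le> (\<Sum>j=1..N. (x j - \<theta>0 j)\<^sup>2)}"
    have "(\<Sum>j=1..N. (\<theta> j - \<theta>0 j)\<^sup>2) \<le> (\<Sum>j=1..N. 2 * (x j - \<theta> j)\<^sup>2 + 2 * (x j - \<theta>0 j)\<^sup>2)"
    proof (rule sum_mono)
      fix j
      have "0 \<le> ((x j - \<theta> j) + (x j - \<theta>0 j))\<^sup>2" by simp
      then show "(\<theta> j - \<theta>0 j)\<^sup>2 \<le> 2 * (x j - \<theta> j)\<^sup>2 + 2 * (x j - \<theta>0 j)\<^sup>2"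
        by (simp add: power2_eq_square algebra_simps)
    qed
    also have "\<dots> = 2 * (\<Sum>j=1..N. (x j - \<theta> j)\<^sup>2) + 2 * (\<Sum>j=1..N. (x j - \<theta>0 j)\<^sup>2)"
      by (simp add: sum.distrib sum_distrib_left)
    finally have "(\<Sum>j=1..N. (\<theta> j - \<theta>0 j)\<^sup>2)
        \<le> 2 * (\<Sum>j=1..N. (x j - \<theta> j)\<^sup>2) + 2 * (\<Sum>j=1..N. (x j - \<theta>0 j)\<^sup>2)" .
    moreover have "(\<Sum>j=1..N. (x j - \<theta>0 j)\<^sup>2) < b / 8"
      using x by (auto simp only: Diff_iff mem_Collect_eq not_le)
    ultimately have "b / 8 \<le> (\<Sum>j=1..N. (x j - \<theta> j)\<^sup>2)"
      using norm_split_at_sieve[OF b far supp tail] by linarith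
    then show "x \<in> {x\<in>space seq_borel. b / 8 \<le> (\<Sum>j=1..N. (x j - \<theta> j)\<^sup>2)}"
      using x by simp
  qed
  then have "emeasure (white_noise n \<theta>) (space seq_borel - {x\<in>space seq_borel. b / 8 \<le> (\<Sum>j=1..N. (x j - \<theta>0 j)\<^sup>2)})
      \<le> emeasure (white_noise n \<theta>) {x\<in>space seq_borel. b / 8 \<le> (\<Sum>j=1..N. (x j - \<theta> j)\<^sup>2)}"
    by (rule emeasure_mono) (unfold sets_white_noise[OF \<theta>], measurable)
  also have "\<dots> \<le> ennreal (2 ^ N * exp (- (real n * (b / 8)) / 4))"
    by (rule white_noise_tail[OF n])
  finally show ?thesis by simp
qed

text \<open>Sequences drawn from a sieve of dimension \<open>N\<close> or more are counted with error probability 1.\<close>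
lemma prior_type_two_error:
  assumes rate: "rate > 0" and \<tau>0: "\<tau>0 > 0" and n: "n \<ge> 1" and b: "b > 0"
    and tail: "\<And>m. (\<Sum>j\<in>{N<..m}. (\<theta>0 j)\<^sup>2) \<le> b / 2" and z: "z \<ge> 1"
  shows "(\<integral>\<^sup>+\<theta>\<in>{\<theta>\<in>space seq_borel. l2_norm_sq (\<lambda>j. \<theta> j - \<theta>0 j) \<ge> ennreal b}.
      emeasure (white_noise n \<theta>) (space seq_borel - {x\<in>space seq_borel. b / 8 \<le> (\<Sum>j=1..N. (x j - \<theta>0 j)\<^sup>2)})
        \<partial>sieve_prior rate \<tau>0 q)
    \<le> ennreal (2 ^ N * exp (- (real n * b) / 32) + exp (rate * z) / z ^ N)"
proof -
  let ?B = "{\<theta>\<in>space seq_borel. l2_norm_sq (\<lambda>j. \<theta> j - \<theta>0 j) \<ge> ennreal b}"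
  let ?A = "space seq_borel - {x\<in>space seq_borel. b / 8 \<le> (\<Sum>j=1..N. (x j - \<theta>0 j)\<^sup>2)}"
  define e where "e = 2 ^ N * exp (- (real n * b) / 32)"
  have e0: "e \<ge> 0" by (simp add: e_def)
  have B: "?B \<in> sets seq_borel" unfolding l2_norm_sq_def by measurable
  have A: "?A \<in> sets seq_borel" by measurable
  have m: "(\<lambda>\<theta>. emeasure (white_noise n \<theta>) ?A * indicator ?B \<theta>) \<in> borel_measurable seq_borel"
    using measurable_white_noise_emeasure[OF A, of n] B by measurable
  have inner: "(\<integral>\<^sup>+\<theta>. emeasure (white_noise n \<theta>) ?A * indicator ?B \<theta> \<partial>sieve_prior_given \<tau>0 q k)
      \<le> ennreal e + indicator {N..} k" for k
  proof -
    interpret G: prob_space "sieve_prior_given \<tau>0 q k" by (rule sets_sieve_prior_given[OF \<tau>0])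
    have "(\<integral>\<^sup>+\<theta>. emeasure (white_noise n \<theta>) ?A * indicator ?B \<theta> \<partial>sieve_prior_given \<tau>0 q k)
      \<le> (\<integral>\<^sup>+\<theta>. ennreal e + indicator {N..} k \<partial>sieve_prior_given \<tau>0 q k)"
    proof (intro nn_integral_mono_AE)
      show "AE \<theta> in sieve_prior_given \<tau>0 q k.
         emeasure (white_noise n \<theta>) ?A * indicator ?B \<theta> \<le> ennreal e + indicator {N..} k"
        using AE_sieve_prior_given_support[OF \<tau>0, of k q]
      proof eventually_elim
        case (elim \<theta>)
        show ?case
        proof (cases "\<theta> \<in> ?B")
          case True
          then have \<theta>: "\<theta> \<in> space seq_borel" by simp
          show ?thesis
          proof (cases "k < N")
            case True
            then have "\<forall>j>N. \<theta> j = 0" using elim by auto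
            then show ?thesis
              using test_type_two_error[OF n b \<theta> _ _ tail] \<open>\<theta> \<in> ?B\<close> True by (simp add: e_def)
          next
            case False
            interpret W: prob_space "white_noise n \<theta>" by (rule white_noise_prob[OF \<theta>])
            have "emeasure (white_noise n \<theta>) ?A \<le> 1" by (rule W.emeasure_le_1)
            then show ?thesis using False \<open>\<theta> \<in> ?B\<close> by (simp add: add_increasing)
          qed
        qed simp
      qed
    qed
    then show ?thesis by (simp add: G.emeasure_space_1)
  qed
  have "(\<integral>\<^sup>+\<theta>\<in>?B. emeasure (white_noise n \<theta>) ?A \<partial>sieve_prior rate \<tau>0 q)
      \<le> (\<integral>\<^sup>+k. ennreal e + indicator {N..} k \<partial>measure_pmf (poisson_pmf rate))"
    unfolding nn_integral_sieve_prior[OF \<tau>0 m] by (intro nn_integral_mono inner)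
  also have "\<dots> = ennreal e + ennreal (measure_pmf.prob (poisson_pmf rate) {N..})"
    by (simp add: nn_integral_add measure_pmf.emeasure_eq_measure)
  also have "\<dots> \<le> ennreal e + ennreal (exp (rate * z) / z ^ N)"
    by (intro add_left_mono ennreal_leI poisson_chernoff[OF rate z])
  also have "\<dots> = ennreal (e + exp (rate * z) / z ^ N)"
    using e0 z by (simp add: ennreal_plus)
  finally show ?thesis unfolding e_def .
qed

section \<open>Contraction at a fixed sample size\<close>

text \<open>
  Everything is an exponential in \<open>R = k ln n\<close>. The comparison with the marginal law costs
  \<open>exp ((L0 + 4) R)\<close>. The threshold \<open>b\<close> and the factor \<open>K\<close> between the cut-off \<open>N = K k\<close> of the test
  and \<open>k\<close> make the chi-square and the Poisson tail at most \<open>exp (- (L0 + 8) R)\<close>. With the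
  level \<open>\<delta> = exp (- R)\<close> for the posterior mass, the set of data where that level is exceeded then has
  probability at most the square root of
  \<open>exp ((L0 + 4) R) \<cdot> 2 exp (- (L0 + 8) R) / exp (- R) = 2 exp (- 3 R)\<close>.
  For the Poisson tail it matters that \<open>ln k\<close> is at least a fixed fraction \<open>c\<close> of \<open>ln n\<close>.
\<close>
lemma posterior_contraction_bound:
  assumes rate: "rate > 0" and \<tau>0: "\<tau>0 > 0" and q: "q \<ge> 0" "q \<le> 1"
    and post: "is_posterior seq_borel seq_borel (sieve_prior rate \<tau>0 q) (white_noise n) \<kappa>"
    and L0: "L0 > 0" and \<beta>: "\<beta> \<ge> 1/2" and \<theta>0: "\<theta>0 \<in> sobolev_class \<beta> L0"
    and k: "1 \<le> k" "k \<le> n"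
    and n: "1 / real n \<le> prior_mass_constant rate \<tau>0 L0" "1 \<le> ln (real n)"
      "rate \<le> ln (real n)" "real K \<le> ln (real n)"
    and K: "1 \<le> K" "L0 + 9 \<le> real K * c"
    and c: "c * ln (real n) \<le> ln (real k)"
    and bias: "real n * real k powr (- 2 * \<beta>) \<le> real k * ln (real n)"
    and b: "32 * (L0 + 9) * (real k * ln (real n) / real n) \<le> b"
  shows "(\<integral>\<^sup>+x. emeasure (\<kappa> x) {\<theta>\<in>space seq_borel. l2_norm_sq (\<lambda>j. \<theta> j - \<theta>0 j) \<ge> ennreal b}
      \<partial>white_noise n \<theta>0) \<le> ennreal (4 / real n)"
proof -
  define R where "R = real k * ln (real n)"
  define N where "N = K * k"
  define A where "A = {x\<in>space seq_borel. b / 8 \<le> (\<Sum>j=1..N. (x j - \<theta>0 j)\<^sup>2)}"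
  let ?B = "{\<theta>\<in>space seq_borel. l2_norm_sq (\<lambda>j. \<theta> j - \<theta>0 j) \<ge> ennreal b}"
  let ?m = "sieve_prior rate \<tau>0 q \<bind> white_noise n"
  have np: "real n > 0" "n \<ge> 1" using k by auto
  have Rn: "ln (real n) \<le> R" unfolding R_def using k n mult_right_mono[of 1 "real k" "ln (real n)"] by simp
  with n have R1: "R \<ge> 1" by simp
  have nb: "32 * (L0 + 9) * R \<le> real n * b"
    using b np by (simp add: R_def field_simps)
  have b0: "b > 0"
    by (rule less_le_trans[OF _ b]) (use L0 R1 np in \<open>auto simp: R_def[symmetric]\<close>)
  have tail: "(\<Sum>j\<in>{N<..m}. (\<theta>0 j)\<^sup>2) \<le> b / 2" for m
  proof -
    have "k \<le> N" using K by (simp add: N_def)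
    then have "(\<Sum>j\<in>{N<..m}. (\<theta>0 j)\<^sup>2) \<le> (\<Sum>j\<in>{k<..m}. (\<theta>0 j)\<^sup>2)"
      by (intro sum_mono2) auto
    also have "\<dots> \<le> L0 * real k powr (- 2 * \<beta>)"
      using \<beta> k by (intro sobolev_tail_le[OF \<theta>0 L0]) auto
    also have "\<dots> \<le> b / 2"
    proof -
      have "L0 * (real n * real k powr (- 2 * \<beta>)) \<le> L0 * R"
        using bias L0 by (intro mult_left_mono) (auto simp: R_def)
      also have "\<dots> \<le> 16 * (L0 + 9) * R" using L0 R1 by (intro mult_right_mono) auto
      also have "\<dots> \<le> real n * b / 2" using nb by (simp add: algebra_simps)
      finally have "real n * (L0 * real k powr (- 2 * \<beta>)) \<le> real n * (b / 2)"
        by (simp add: ac_simps)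
      then show ?thesis using np by (simp only: mult_le_cancel_left_pos)
    qed
    finally show ?thesis .
  qed
  have chi: "2 ^ N * exp (- (real n * b) / 32) \<le> exp (- ((L0 + 8) * R))"
  proof -
    have "(2::real) ^ N \<le> exp 1 ^ N"
      using exp_ge_add_one_self[of 1] by (intro power_mono) auto
    also have "\<dots> = exp (real K * real k)"
      by (simp add: exp_of_nat_mult[symmetric] N_def)
    also have "\<dots> \<le> exp R"
      using mult_right_mono[OF n(4), of "real k"] by (simp add: R_def mult.commute)
    finally have "(2::real) ^ N \<le> exp R" .
    moreover have "exp (- (real n * b) / 32) \<le> exp (- ((L0 + 9) * R))"
      using nb by (simp add: algebra_simps)
    ultimately have "2 ^ N * exp (- (real n * b) / 32) \<le> exp R * exp (- ((L0 + 9) * R))"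
      by (intro mult_mono) auto
    also have "\<dots> = exp (- ((L0 + 8) * R))"
      unfolding exp_add[symmetric] by (rule arg_cong[where f=exp]) (simp add: algebra_simps)
    finally show ?thesis .
  qed
  have pois: "exp (rate * real k) / real k ^ N \<le> exp (- ((L0 + 8) * R))"
  proof -
    have "real k ^ N = exp (real N * ln (real k))"
      using k by (simp add: exp_of_nat_mult)
    then have "exp (rate * real k) / real k ^ N = exp (rate * real k - real N * ln (real k))"
      by (simp add: exp_diff)
    also have "\<dots> \<le> exp (- ((L0 + 8) * R))"
    proof -
      have "rate * real k \<le> R" using mult_right_mono[OF n(3), of "real k"] by (simp add: R_def mult.commute)
      moreover have "(L0 + 9) * R \<le> (real K * c) * R" using K R1 by (intro mult_right_mono) auto
      moreover have "real N * (c * ln (real n)) \<le> real N * ln (real k)"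
        using c by (intro mult_left_mono) auto
      moreover have "real N * (c * ln (real n)) = (real K * c) * R" by (simp add: N_def R_def)
      moreover have "(L0 + 9) * R = (L0 + 8) * R + R" by (simp add: algebra_simps)
      ultimately have "rate * real k - real N * ln (real k) \<le> - ((L0 + 8) * R)" by linarith
      then show ?thesis by simp
    qed
    finally show ?thesis .
  qed
  have \<theta>0s: "\<theta>0 \<in> space seq_borel" using \<theta>0 by (simp add: sobolev_class_def)
  have A: "A \<in> sets seq_borel" unfolding A_def by measurable
  have "(\<integral>\<^sup>+x. emeasure (\<kappa> x) ?B \<partial>white_noise n \<theta>0)
      \<le> emeasure (white_noise n \<theta>0) A + ennreal (exp (- R))
        + ennreal (sqrt (exp ((L0 + 4) * R) * (2 * exp (- ((L0 + 8) * R)) / exp (- R))))"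
  proof (rule posterior_mass_le_of_test[OF post white_noise_prob[OF \<theta>0s] sets_white_noise[OF \<theta>0s] _ _ _ _ A])
    show "(emeasure (white_noise n \<theta>0) S)\<^sup>2 \<le> ennreal (exp ((L0 + 4) * R)) * emeasure ?m S"
      if "S \<in> sets seq_borel" for S
      unfolding R_def by (rule marginal_dominates_truth[OF rate \<tau>0 q L0 \<beta> \<theta>0 k n(1,2) bias that])
    show "sets ?m = sets seq_borel"
    proof (rule sets_bind)
      show "sets (white_noise n \<theta>) = sets seq_borel" if "\<theta> \<in> space (sieve_prior rate \<tau>0 q)" for \<theta>
        using that sets_white_noise by (simp add: sets_sieve_prior[OF \<tau>0])
      show "space (sieve_prior rate \<tau>0 q) \<noteq> {}"
        using \<theta>0s by (auto simp: sets_sieve_prior[OF \<tau>0])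
    qed
    show "?B \<in> sets seq_borel" unfolding l2_norm_sq_def by measurable
    have "(\<integral>\<^sup>+\<theta>\<in>?B. emeasure (white_noise n \<theta>) (space seq_borel - A) \<partial>sieve_prior rate \<tau>0 q)
        \<le> ennreal (2 ^ N * exp (- (real n * b) / 32) + exp (rate * real k) / real k ^ N)"
      unfolding A_def using k by (intro prior_type_two_error[OF rate \<tau>0 np(2) b0 tail]) auto
    also have "\<dots> \<le> ennreal (2 * exp (- ((L0 + 8) * R)))"
      using chi pois by (intro ennreal_leI) linarith
    finally show "(\<integral>\<^sup>+\<theta>\<in>?B. emeasure (white_noise n \<theta>) (space seq_borel - A) \<partial>sieve_prior rate \<tau>0 q)
        \<le> ennreal (2 * exp (- ((L0 + 8) * R)))" .
  qed auto
  also have "\<dots> \<le> ennreal (exp (- R)) + ennreal (exp (- R)) + ennreal (2 * exp (- R))"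
  proof (intro add_mono ennreal_leI order_refl)
    have "emeasure (white_noise n \<theta>0) A \<le> ennreal (2 ^ N * exp (- (real n * (b / 8)) / 4))"
      unfolding A_def by (rule white_noise_tail[OF np(2)])
    also have "\<dots> \<le> ennreal (exp (- R))"
    proof (rule ennreal_leI)
      have "2 ^ N * exp (- (real n * (b / 8)) / 4) = 2 ^ N * exp (- (real n * b) / 32)" by simp
      also note chi
      also have "exp (- ((L0 + 8) * R)) \<le> exp (- R)"
        using mult_right_mono[of 1 "L0 + 8" R] L0 R1 by simp
      finally show "2 ^ N * exp (- (real n * (b / 8)) / 4) \<le> exp (- R)" .
    qed
    finally show "emeasure (white_noise n \<theta>0) A \<le> ennreal (exp (- R))" .
    have exponent: "(L0 + 4) * R + - ((L0 + 8) * R) - - R = - 3 * R" by (simp add: algebra_simps)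
    have "exp ((L0 + 4) * R) * (2 * exp (- ((L0 + 8) * R)) / exp (- R))
        = 2 * exp ((L0 + 4) * R + - ((L0 + 8) * R) - - R)"
      by (simp only: exp_add exp_diff) simp
    also have "\<dots> \<le> 4 * exp (- 2 * R)"
      unfolding exponent using R1 by (intro mult_mono) auto
    also have "\<dots> = (2 * exp (- R))\<^sup>2"
      by (simp add: power_mult_distrib exp_double[symmetric])
    finally show "sqrt (exp ((L0 + 4) * R) * (2 * exp (- ((L0 + 8) * R)) / exp (- R))) \<le> 2 * exp (- R)"
      by (intro real_le_lsqrt) auto
  qed
  also have "\<dots> = ennreal (4 * exp (- R))"
    by (simp add: ennreal_plus[symmetric] del: ennreal_plus)
  also have "\<dots> \<le> ennreal (4 / real n)"
  proof (rule ennreal_leI)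
    have "exp (- R) \<le> exp (- ln (real n))" using Rn by simp
    also have "\<dots> = 1 / real n" using np by (simp add: exp_minus inverse_eq_divide)
    finally show "4 * exp (- R) \<le> 4 / real n" by simp
  qed
  finally show ?thesis .
qed

section \<open>Choice of the sieve dimension and conclusion\<close>

text \<open>
  \<open>u = (n / ln n)\<^bsup>1/(2\<beta>+1)\<^esup>\<close> solves \<open>n u\<^bsup>-2\<beta>\<^esup> = u ln n\<close>, the balance of bias and
  complexity, and both sides equal \<open>n\<close> times the squared rate. Rounding up to \<open>k \<le> 2 u\<close> loses the
  factor 2.
\<close>
lemma sieve_dimension:
  assumes \<beta>: "1/2 \<le> \<beta>" "\<beta> \<le> \<beta>2" and n: "1 \<le> ln (real n)"
  obtains k where "1 \<le> k" "k \<le> n"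
    "real n * real k powr (- 2 * \<beta>) \<le> real k * ln (real n)"
    "1 / (2 * (2 * \<beta>2 + 1)) * ln (real n) \<le> ln (real k)"
    "real k * ln (real n) / real n \<le> 2 * (rate_eps 1 \<beta> n)\<^sup>2"
proof
  define u where "u = (real n / ln (real n)) powr (1 / (2 * \<beta> + 1))"
  define k where "k = nat \<lceil>u\<rceil>"
  have np: "real n > 0"
  proof (rule ccontr)
    assume "\<not> real n > 0" then show False using n by simp
  qed
  (* ln x <= x / 2 holds for all x > 0, because ln (x / 2) <= x / 2 - 1 and ln 2 < 1 *)
  have lnln: "ln (ln (real n)) \<le> ln (real n) / 2"
    using ln_le_minus_one[of "ln (real n) / 2"] n ln2_le_25_over_36 by (simp add: ln_div)
  have \<beta>p: "2 * \<beta> + 1 > 0" "2 * \<beta>2 + 1 > 0" using \<beta> by auto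
  have ratio: "real n / ln (real n) \<ge> 1"
  proof -
    have "ln (real n) \<le> real n" using ln_le_minus_one[OF np] by simp
    then show ?thesis using n by (subst le_divide_eq_1_pos) linarith+
  qed
  have u1: "u \<ge> 1" unfolding u_def using ratio \<beta>p by (simp add: ge_one_powr_ge_zero)
  have up: "u powr (2 * \<beta> + 1) = real n / ln (real n)"
    using \<beta>p n by (simp add: u_def powr_powr)
  have un: "u \<le> real n"
  proof -
    have "u \<le> (real n / ln (real n)) powr 1"
      unfolding u_def using ratio \<beta> by (intro powr_mono) auto
    also have "\<dots> = real n / ln (real n)" using n by simp
    also have "\<dots> \<le> real n" using n np by (simp add: divide_le_eq mult_le_cancel_left1)
    finally show ?thesis .
  qed
  have ku: "u \<le> real k" "real k \<le> u + 1" unfolding k_def using u1 by linarith+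
  have var: "real n * u powr (- 2 * \<beta>) = u * ln (real n)"
  proof -
    have "u powr (2 * \<beta> + 1) = u * u powr (2 * \<beta>)" using u1 by (simp add: powr_add)
    with up have "real n = u * u powr (2 * \<beta>) * ln (real n)" using n by (simp add: field_simps)
    then have "real n * u powr (- 2 * \<beta>) = u * ln (real n) * (u powr (2 * \<beta>) * u powr (- 2 * \<beta>))"
      by (metis mult.assoc mult.commute)
    also have "u powr (2 * \<beta>) * u powr (- 2 * \<beta>) = 1" using u1 by (simp add: powr_add[symmetric])
    finally show ?thesis by simp
  qed
  show "1 \<le> k" using ku u1 by linarith
  show "k \<le> n" unfolding k_def using un by (simp add: ceiling_le_iff nat_le_iff)
  show "real n * real k powr (- 2 * \<beta>) \<le> real k * ln (real n)"
  proof -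
    have "real n * real k powr (- 2 * \<beta>) \<le> real n * u powr (- 2 * \<beta>)"
      using ku u1 \<beta> by (intro mult_left_mono powr_mono2') auto
    also have "\<dots> \<le> real k * ln (real n)" unfolding var using ku n by (intro mult_right_mono) auto
    finally show ?thesis .
  qed
  show "1 / (2 * (2 * \<beta>2 + 1)) * ln (real n) \<le> ln (real k)"
  proof -
    have "1 / (2 * (2 * \<beta>2 + 1)) * ln (real n) = 1 / (2 * \<beta>2 + 1) * (ln (real n) / 2)"
      by simp
    also have "\<dots> \<le> 1 / (2 * \<beta> + 1) * (ln (real n) / 2)"
      using \<beta> n by (intro mult_right_mono divide_left_mono mult_pos_pos) auto
    also have "\<dots> \<le> 1 / (2 * \<beta> + 1) * (ln (real n) - ln (ln (real n)))"
      using \<beta> lnln by (intro mult_left_mono) auto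
    also have "\<dots> = ln u"
      using np n by (simp add: u_def ln_powr ln_div)
    also have "\<dots> \<le> ln (real k)" using ku u1 by simp
    finally show ?thesis .
  qed
  show "real k * ln (real n) / real n \<le> 2 * (rate_eps 1 \<beta> n)\<^sup>2"
  proof -
    have "(rate_eps 1 \<beta> n)\<^sup>2 = (ln (real n) / real n) powr (2 * \<beta> / (2 * \<beta> + 1))"
      unfolding rate_eps_def using np n
      by (simp add: power2_eq_square powr_add[symmetric] add_divide_distrib[symmetric])
    also have "\<dots> = (real n / ln (real n)) powr (- (2 * \<beta> / (2 * \<beta> + 1)))"
      using np n by (simp add: powr_minus_divide powr_divide)
    also have "\<dots> = u powr (- 2 * \<beta>)"
      by (simp add: u_def powr_powr)
    finally have "real n * (rate_eps 1 \<beta> n)\<^sup>2 = u * ln (real n)" using var by simp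
    moreover have "real k * ln (real n) \<le> (2 * u) * ln (real n)"
      using ku u1 n by (intro mult_right_mono) auto
    ultimately show ?thesis using np by (simp add: field_simps)
  qed
qed

theorem proposition2:
  fixes rate \<tau>0 q L0 \<beta>1 \<beta>2 :: real
    and posterior :: "nat \<Rightarrow> (nat \<Rightarrow> real) \<Rightarrow> (nat \<Rightarrow> real) measure"
  assumes "rate > 0" and "\<tau>0 > 0" and "1/2 < q" and "q \<le> 1"
    and "\<And>n. n \<ge> 1 \<Longrightarrow>
           is_posterior seq_borel seq_borel (sieve_prior rate \<tau>0 q) (white_noise n) (posterior n)"
    and "L0 > 0" and "1/2 < \<beta>1" and "\<beta>1 \<le> \<beta>2"
  shows "\<exists>\<epsilon>0>0. \<exists>M0. \<forall>M\<ge>M0.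
    (\<lambda>n. SUP \<beta>\<in>{\<beta>1..\<beta>2}. SUP \<theta>0\<in>sobolev_class \<beta> L0.
       \<integral>\<^sup>+ x. emeasure (posterior n x)
         {\<theta> \<in> space seq_borel.
            l2_norm_sq (\<lambda>j. \<theta> j - \<theta>0 j)
              \<ge> ennreal (M * (ln (real n) / slowly_varying n) * (rate_eps \<epsilon>0 \<beta> n)\<^sup>2)}
       \<partial>white_noise n \<theta>0)
    \<longlonglongrightarrow> 0"
proof (rule exI[of _ 1], intro conjI, simp, rule exI[of _ "64 * (L0 + 9)"], intro allI impI)
  (* 64 is twice the factor 32 of posterior_contraction_bound: the rounding in sieve_dimension
     costs the 2. *)
  fix M :: real assume M: "64 * (L0 + 9) \<le> M"
  (* ln k is about (ln n - ln ln n) / (2 \<beta> + 1); replacing \<beta> by \<beta>2 makes c, and with it K,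
     independent of \<beta>. *)
  define c where "c = 1 / (2 * (2 * \<beta>2 + 1))"
  have c: "c > 0" using assms unfolding c_def by (intro divide_pos_pos) auto
  obtain K0 :: nat where "(L0 + 9) / c \<le> real K0" using real_arch_simple by blast
  define K where "K = Suc K0"
  have K: "1 \<le> K" "L0 + 9 \<le> real K * c"
  proof -
    have "(L0 + 9) / c \<le> real K" using \<open>(L0 + 9) / c \<le> real K0\<close> by (simp add: K_def)
    then show "L0 + 9 \<le> real K * c" using c by (simp add: divide_le_eq)
  qed (simp add: K_def)
  have y: "prior_mass_constant rate \<tau>0 L0 > 0"
    using assms by (simp add: prior_mass_constant_def)
  have lim: "filterlim (\<lambda>n. ln (real n)) at_top sequentially"
    by (rule filterlim_compose[OF ln_at_top filterlim_real_sequentially])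
  have inv: "\<forall>\<^sub>F n in sequentially. 1 / real n \<le> prior_mass_constant rate \<tau>0 L0"
    using order_tendstoD(2)[OF lim_1_over_n y] by eventually_elim simp
  have big: "\<forall>\<^sub>F n in sequentially. C \<le> ln (real n)" for C
    using lim by (simp add: filterlim_at_top)
  show "(\<lambda>n. SUP \<beta>\<in>{\<beta>1..\<beta>2}. SUP \<theta>0\<in>sobolev_class \<beta> L0.
       \<integral>\<^sup>+ x. emeasure (posterior n x)
         {\<theta> \<in> space seq_borel.
            l2_norm_sq (\<lambda>j. \<theta> j - \<theta>0 j)
              \<ge> ennreal (M * (ln (real n) / slowly_varying n) * (rate_eps 1 \<beta> n)\<^sup>2)}
       \<partial>white_noise n \<theta>0) \<longlonglongrightarrow> 0"
    (is "?f \<longlonglongrightarrow> 0")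
  proof (rule tendsto_sandwich[OF _ _ tendsto_const])
    show "\<forall>\<^sub>F n in sequentially. 0 \<le> ?f n" by simp
    show "(\<lambda>n. ennreal (4 / real n)) \<longlonglongrightarrow> 0"
      using tendsto_ennrealI[OF lim_const_over_n[of 4]] by simp
    show "\<forall>\<^sub>F n in sequentially. ?f n \<le> ennreal (4 / real n)"
      using inv big[of 1] big[of rate] big[of "real K"] eventually_ge_at_top[of 1]
    proof eventually_elim
      case (elim n)
      show ?case
      proof (intro SUP_least)
        fix \<beta> \<theta>0 assume \<beta>: "\<beta> \<in> {\<beta>1..\<beta>2}" and \<theta>0: "\<theta>0 \<in> sobolev_class \<beta> L0"
        then have \<beta>2: "1/2 \<le> \<beta>" "\<beta> \<le> \<beta>2" using assms by auto
        obtain k where k: "1 \<le> k" "k \<le> n"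
          and bias: "real n * real k powr (- 2 * \<beta>) \<le> real k * ln (real n)"
          and lnk: "c * ln (real n) \<le> ln (real k)"
          and eps: "real k * ln (real n) / real n \<le> 2 * (rate_eps 1 \<beta> n)\<^sup>2"
          using sieve_dimension[OF \<beta>2 elim(2)] unfolding c_def by blast
        have "32 * (L0 + 9) * (real k * ln (real n) / real n) \<le> 32 * (L0 + 9) * (2 * (rate_eps 1 \<beta> n)\<^sup>2)"
          using eps assms by (intro mult_left_mono) auto
        also have "\<dots> = 64 * (L0 + 9) * (rate_eps 1 \<beta> n)\<^sup>2" by simp
        also have "\<dots> \<le> M * (rate_eps 1 \<beta> n)\<^sup>2" using M by (intro mult_right_mono) auto
        also have "\<dots> = M * (ln (real n) / slowly_varying n) * (rate_eps 1 \<beta> n)\<^sup>2"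
          using elim(2) by (simp add: slowly_varying_def)
        finally show "(\<integral>\<^sup>+ x. emeasure (posterior n x)
           {\<theta> \<in> space seq_borel.
              l2_norm_sq (\<lambda>j. \<theta> j - \<theta>0 j)
                \<ge> ennreal (M * (ln (real n) / slowly_varying n) * (rate_eps 1 \<beta> n)\<^sup>2)}
           \<partial>white_noise n \<theta>0) \<le> ennreal (4 / real n)"
          using assms(3)
          by (intro posterior_contraction_bound[OF assms(1,2) _ assms(4) assms(5)[OF elim(5)]
                assms(6) \<beta>2(1) \<theta>0 k elim(1,2,3,4) K lnk bias]) auto
      qed
    qed
  qed
qed

end
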